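(* Let $K$ be a compact $\mathcal{C}^5$ maximally totally real submanifold without boundary in $\mathbb{C}^n$. Let $\mu$ be a smooth volume form on $K$ regarded as a measure on $\mathbb{C}^n$. Let $Q\in\mathcal{C}^{1,\delta}(K)$ be real-valued, for some constant $\delta>0$. Let $B_k$ be the Bergman kernel function of order $k$ associated to $\mu$ with weight $Q$. Then there exists a constant $C>0$ such that $$\sup_K B_k\le C\,k^n$$ for every $k\ge 1$.
   Context: A submanifold $K$ of $\mathbb{C}^n$ is maximally totally real if it has real dimension $n$ and $T_pK+J\,T_pK=T_p\mathbb{C}^n$ for every $p\in K$, where $J$ is the complex structure on the real tangent spaces of $\mathbb{C}^n$. $\mathcal{P}_k$ is the space of restrictions to $K$ of complex polynomials of degree at most $k$ on $\mathbb{C}^n$, $\|s\|^2_{L^2(\mu,kQ)}=\int_K|s|^2e^{-2kQ}\,d\mu$, and for $x\in K$ $$B_k(x)=\sup_{s\in\mathcal{P}_k,\,s\ne0}\frac{|s(x)e^{-kQ(x)}|^2}{\|s\|^2_{L^2(\mu,kQ)}}.$$ *)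

theory Defs
  imports "HOL-Analysis.Analysis"
begin

text \<open>The set \<open>U\<close> is meant to be open. All directional derivatives of \<open>f\<close>, and not only the
  partial derivatives, are required to be of class \<open>C^r\<close>; this avoids choosing a basis.\<close>

primrec Ck_on :: "nat \<Rightarrow> ('a::euclidean_space \<Rightarrow> 'b::real_normed_vector) \<Rightarrow> 'a set \<Rightarrow> bool" where
  "Ck_on 0 f U \<longleftrightarrow> continuous_on U f"
| "Ck_on (Suc r) f U \<longleftrightarrow>
     (\<forall>u\<in>U. f differentiable (at u)) \<and>
     (\<forall>h. Ck_on r (\<lambda>u. frechet_derivative f (at u) h) U)"

text \<open>A local parametrization of \<open>K\<close>: an immersion of class \<open>C^r\<close> (with \<open>r \<ge> 1\<close>) of an open set
  of \<open>real ^ 'd\<close> that is a homeomorphism onto a relatively open subset of \<open>K\<close>. The parameter domain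
  is open in the whole space, so a set covered by such parametrizations has no boundary.\<close>

definition local_param ::
  "nat \<Rightarrow> 'a::euclidean_space set \<Rightarrow> (real ^ 'd) set \<Rightarrow> (real ^ 'd \<Rightarrow> 'a) \<Rightarrow> bool" where
  "local_param r K U \<phi> \<longleftrightarrow>
     open U \<and> Ck_on r \<phi> U \<and> (\<forall>u\<in>U. inj (frechet_derivative \<phi> (at u))) \<and>
     openin (top_of_set K) (\<phi> ` U) \<and> (\<exists>\<psi>. homeomorphism U (\<phi> ` U) \<phi> \<psi>)"

text \<open>The type argument carries the real dimension \<open>CARD('d)\<close>.\<close>

definition submanifold :: "'d::finite itself \<Rightarrow> nat \<Rightarrow> 'a::euclidean_space set \<Rightarrow> bool" where
  "submanifold _ r K \<longleftrightarrow>
     (\<forall>p\<in>K. \<exists>U (\<phi> :: real ^ 'd \<Rightarrow> 'a). local_param r K U \<phi> \<and> p \<in> \<phi> ` U)"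

definition tangent_space :: "'a::euclidean_space set \<Rightarrow> 'a \<Rightarrow> 'a set" where
  "tangent_space K p =
     {v. \<exists>(\<gamma> :: real \<Rightarrow> 'a) e. e > 0 \<and> Ck_on 1 \<gamma> {-e<..<e} \<and> \<gamma> ` {-e<..<e} \<subseteq> K \<and>
           \<gamma> 0 = p \<and> (\<gamma> has_vector_derivative v) (at 0)}"

definition maximally_totally_real :: "nat \<Rightarrow> (complex ^ 'n) set \<Rightarrow> bool" where
  "maximally_totally_real r K \<longleftrightarrow>
     submanifold TYPE('n) r K \<and>
     (\<forall>p\<in>K. {v + \<i> *s w | v w. v \<in> tangent_space K p \<and> w \<in> tangent_space K p} = UNIV)"

definition alternating_form_on ::
  "'a::real_vector set \<Rightarrow> (('d::finite \<Rightarrow> 'a) \<Rightarrow> real) \<Rightarrow> bool" where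
  "alternating_form_on T f \<longleftrightarrow>
     (\<forall>v i x y a b. range v \<subseteq> T \<longrightarrow> x \<in> T \<longrightarrow> y \<in> T \<longrightarrow>
        f (v(i := a *\<^sub>R x + b *\<^sub>R y)) = a * f (v(i := x)) + b * f (v(i := y))) \<and>
     (\<forall>v i j. range v \<subseteq> T \<longrightarrow> i \<noteq> j \<longrightarrow> v i = v j \<longrightarrow> f v = 0)"

text \<open>The coefficient \<open>g\<close> in \<open>\<phi>\<^sup>* \<omega> = g du\<^sub>1 \<and> \<dots> \<and> du\<^sub>d\<close>.\<close>

definition form_coeff ::
  "('a \<Rightarrow> ('d \<Rightarrow> 'a) \<Rightarrow> real) \<Rightarrow> (real ^ 'd \<Rightarrow> 'a::euclidean_space) \<Rightarrow> real ^ 'd \<Rightarrow> real" where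
  "form_coeff \<omega> \<phi> u = \<omega> (\<phi> u) (\<lambda>i. frechet_derivative \<phi> (at u) (axis i 1))"

text \<open>A nowhere vanishing form of top degree on a submanifold of class \<open>C^r\<close>. Since coordinate
  changes are only of class \<open>C^r\<close>, with Jacobians of class \<open>C^(r-1)\<close>, the latter is the highest
  regularity of the coefficients that does not depend on the coordinates, and this is what
  smoothness of a form on such a submanifold means here. In particular it holds for restrictions
  of forms that are of class \<open>C^\<infinity>\<close> on the ambient space.\<close>

definition smooth_volume_form ::
  "nat \<Rightarrow> 'a::euclidean_space set \<Rightarrow> ('a \<Rightarrow> ('d::finite \<Rightarrow> 'a) \<Rightarrow> real) \<Rightarrow> bool" where
  "smooth_volume_form r K \<omega> \<longleftrightarrow>
     (\<forall>x\<in>K. alternating_form_on (tangent_space K x) (\<omega> x)) \<and>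
     (\<forall>x\<in>K. \<exists>v. range v \<subseteq> tangent_space K x \<and> \<omega> x v \<noteq> 0) \<and>
     (\<forall>U (\<phi> :: real ^ 'd \<Rightarrow> 'a). local_param r K U \<phi> \<longrightarrow> Ck_on (r - 1) (form_coeff \<omega> \<phi>) U)"

text \<open>The Borel measure \<open>\<bar>\<omega>\<bar>\<close> on the ambient space: it is carried by \<open>K\<close> and has density
  \<open>\<bar>g\<bar>\<close> with respect to Lebesgue measure in each local parametrization.\<close>

definition is_form_measure ::
  "nat \<Rightarrow> 'a::euclidean_space set \<Rightarrow> ('a \<Rightarrow> ('d::finite \<Rightarrow> 'a) \<Rightarrow> real) \<Rightarrow> 'a measure \<Rightarrow> bool" where
  "is_form_measure r K \<omega> \<mu> \<longleftrightarrow>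
     sets \<mu> = sets borel \<and> emeasure \<mu> (- K) = 0 \<and>
     (\<forall>U (\<phi> :: real ^ 'd \<Rightarrow> 'a). local_param r K U \<phi> \<longrightarrow>
        (\<forall>A\<in>sets borel. A \<subseteq> \<phi> ` U \<longrightarrow>
           emeasure \<mu> A =
             (\<integral>\<^sup>+u\<in>U \<inter> \<phi> -` A. ennreal \<bar>form_coeff \<omega> \<phi> u\<bar> \<partial>lborel)))"

text \<open>In each local parametrization, the function is differentiable with first derivatives that are
  Hoelder continuous of exponent \<open>\<delta>\<close> on compact sets. Only the values of \<open>Q\<close> on \<open>K\<close> matter.\<close>

definition C1_Hoelder_on ::
  "'d::finite itself \<Rightarrow> nat \<Rightarrow> real \<Rightarrow> 'a::euclidean_space set \<Rightarrow> ('a \<Rightarrow> real) \<Rightarrow> bool" where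
  "C1_Hoelder_on _ r \<delta> K Q \<longleftrightarrow>
     (\<forall>U (\<phi> :: real ^ 'd \<Rightarrow> 'a). local_param r K U \<phi> \<longrightarrow>
        (\<forall>u\<in>U. (Q \<circ> \<phi>) differentiable (at u)) \<and>
        (\<forall>L h. compact L \<longrightarrow> L \<subseteq> U \<longrightarrow>
           (\<exists>M. \<forall>u\<in>L. \<forall>v\<in>L.
              \<bar>frechet_derivative (Q \<circ> \<phi>) (at u) h - frechet_derivative (Q \<circ> \<phi>) (at v) h\<bar>
                \<le> M * dist u v powr \<delta>)))"

lemma finite_multi_indices: "finite {\<alpha> :: 'n::finite \<Rightarrow> nat. (\<Sum>i\<in>UNIV. \<alpha> i) \<le> k}"
proof (rule finite_subset)
  show "{\<alpha> :: 'n \<Rightarrow> nat. (\<Sum>i\<in>UNIV. \<alpha> i) \<le> k} \<subseteq> (\<Pi>\<^sub>E i\<in>UNIV. {..k})"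
  proof
    fix \<alpha> :: "'n \<Rightarrow> nat"
    assume "\<alpha> \<in> {\<alpha>. (\<Sum>i\<in>UNIV. \<alpha> i) \<le> k}"
    then have "\<alpha> i \<le> k" for i
      using member_le_sum[of i UNIV \<alpha>] by simp
    then show "\<alpha> \<in> (\<Pi>\<^sub>E i\<in>UNIV. {..k})"
      by (auto simp: PiE_def Pi_def)
  qed
  show "finite (\<Pi>\<^sub>E i\<in>(UNIV :: 'n set). {..k})"
    by (rule finite_PiE) simp_all
qed

definition polynomials_upto :: "nat \<Rightarrow> (complex ^ 'n \<Rightarrow> complex) set" where
  "polynomials_upto k =
     {(\<lambda>z. \<Sum>\<alpha> | (\<Sum>i\<in>UNIV. \<alpha> i) \<le> k. c \<alpha> * (\<Prod>i\<in>UNIV. (z $ i) ^ \<alpha> i)) | c. True}"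

definition polys_on :: "(complex ^ 'n) set \<Rightarrow> nat \<Rightarrow> (complex ^ 'n \<Rightarrow> complex) set" where
  "polys_on K k = (\<lambda>p. restrict p K) ` polynomials_upto k"

definition L2_norm_sq ::
  "'a set \<Rightarrow> 'a measure \<Rightarrow> ('a \<Rightarrow> real) \<Rightarrow> nat \<Rightarrow> ('a \<Rightarrow> complex) \<Rightarrow> ennreal" where
  "L2_norm_sq K \<mu> Q k s =
     (\<integral>\<^sup>+x\<in>K. ennreal ((cmod (s x))\<^sup>2 * exp (- 2 * real k * Q x)) \<partial>\<mu>)"

text \<open>The supremum is taken in the extended nonnegative reals, so that it always exists. The zero
  element of the space of restrictions is the restriction to \<open>K\<close> of the zero function.\<close>

definition bergman ::
  "(complex ^ 'n) set \<Rightarrow> (complex ^ 'n) measure \<Rightarrow> (complex ^ 'n \<Rightarrow> real) \<Rightarrow> nat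
     \<Rightarrow> complex ^ 'n \<Rightarrow> ennreal" where
  "bergman K \<mu> Q k x =
     (SUP s \<in> polys_on K k - {\<lambda>z\<in>K. 0}.
        ennreal ((cmod (s x * of_real (exp (- real k * Q x))))\<^sup>2) / L2_norm_sq K \<mu> Q k s)"

end

theory Submission
  imports Defs "HOL-Complex_Analysis.Conformal_Mappings"
begin

text \<open>A bound on the Bergman kernel function by \<open>C k\<^sup>n\<close> is an inequality between the weighted sup norm and the
  weighted \<open>L\<^sup>2\<close> norm of a polynomial \<open>s\<close> of degree at most \<open>k\<close>. If \<open>\<bar>s\<bar> exp (- k Q)\<close> attains its maximum over
  \<open>K\<close> at \<open>p\<close>, it suffices that \<open>\<bar>s\<bar> exp (- k Q)\<close> stays comparable to this maximum on a ball of radius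
  proportional to \<open>1 / k\<close> around \<open>p\<close>, because the part of \<open>K\<close> in that ball has mass proportional to
  \<open>k ^ (- n)\<close>; this is \<open>L2_norm_lower_bound\<close>. By the Schwarz lemma it is enough to bound \<open>\<bar>s\<bar>\<close> from above on
  such a ball in \<open>\<complex>\<^sup>n\<close>, and so everything rests on one estimate, \<open>near_bound_uniform\<close>: if
  \<open>u = ln \<bar>s\<bar> / k\<close> is at most \<open>Q\<close> on \<open>K\<close>, then \<open>u\<close> exceeds \<open>Q\<close> at distance \<open>d\<close> from \<open>K\<close> by at most \<open>A d\<close>, with \<open>A\<close>
  independent of \<open>k\<close> and \<open>s\<close>. In other words, the weighted extremal function of \<open>K\<close> is Lipschitz at \<open>K\<close>.

  The proof of this estimate uses linear discs instead of discs attached exactly to \<open>K\<close>. Because \<open>K\<close> is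
  maximally totally real, every point near \<open>K\<close> lies on a complex line whose real direction is tangent to
  \<open>K\<close>. On a long flat rectangle in this line the bottom side is much closer to \<open>K\<close> than the scale under
  consideration, and the distance to \<open>K\<close> grows no faster than the imaginary part
  (\<open>analytic_disc_estimate\<close>). The maximum principle on the rectangle compares the constant in the bound
  at distance \<open>D\<close> with the one at distance \<open>D / 2\<close>, with an error that is summable over dyadic scales
  (\<open>near_bound_halve\<close>). The regularity \<open>C\<^sup>1\<^sup>,\<^sup>\<delta>\<close> of \<open>Q\<close> enters here: the linear part of \<open>Q\<close> is harmonic along the
  line and costs nothing, and the remainder is of higher order than \<open>D\<close>.

  The bound at a fixed scale is obtained at the same time. The Bernstein--Walsh inequality for a ball
  bounds \<open>u\<close> at distance \<open>d0\<close> by its values at distance \<open>d0 / 8\<close> plus \<open>ln 8\<close>, and the latter values are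
  controlled by \<open>A\<close> itself. Together these facts show that any admissible \<open>A\<close> can be replaced by \<open>A / 2\<close>
  plus a universal constant (\<open>near_bound_improve\<close>); since some \<open>A\<close> is admissible for each \<open>s\<close>, a universal
  one is.

  The geometric input, uniform over the compact set \<open>K\<close>, is that \<open>K\<close> and \<open>Q\<close> are osculated by their
  linearizations and that the measure has a positive density (\<open>local_geometry\<close>).\<close>

section \<open>One complex variable and polynomials on complex lines\<close>

text \<open>At height \<open>y\<close> only the fraction \<open>y / h\<close> of the bound for \<open>ln \<bar>g\<bar>\<close> on the other three sides is felt, up to
  a factor that tends to \<open>1\<close> as the rectangle becomes flat. The reason is that the harmonic function \<open>m t \<tau> = \<kappa> (t\<^sup>2 - \<tau>\<^sup>2) + \<beta> \<tau>\<close> is at least \<open>1\<close> on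
  those sides and nonnegative on the bottom. A factor tending to \<open>1\<close>, rather than merely a bounded
  one, is what allows the estimate to be iterated over infinitely many scales.\<close>

lemma rectangle_two_constants:
  fixes g :: "complex \<Rightarrow> complex"
  assumes hol: "g holomorphic_on UNIV"
    and h: "0 < h" "2 * h \<le> r" and e: "0 \<le> e" and y: "0 \<le> y" "y \<le> h"
    and rect: "\<And>t \<tau>. \<bar>t\<bar> \<le> r \<Longrightarrow> 0 \<le> \<tau> \<Longrightarrow> \<tau> \<le> h \<Longrightarrow> cmod (g (Complex t \<tau>)) \<le> exp e"
    and bottom: "\<And>t. \<bar>t\<bar> \<le> r \<Longrightarrow> cmod (g (Complex t 0)) \<le> 1"
  shows "cmod (g (Complex 0 y)) \<le> exp (e * (y / h) * (1 + 2 * h\<^sup>2 / r\<^sup>2))"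
proof -
  \<comment> \<open>The quadratic part alone exceeds \<open>1\<close> on the vertical sides, since \<open>h \<le> r / 2\<close>; then \<open>\<beta>\<close> is chosen
    so that \<open>m t h = \<kappa> t\<^sup>2 + 1\<close> on the top side.\<close>
  define \<kappa> where "\<kappa> = 2 / r\<^sup>2"
  define \<beta> where "\<beta> = 1 / h + \<kappa> * h"
  define m where "m t \<tau> = \<kappa> * (t\<^sup>2 - \<tau>\<^sup>2) + \<beta> * \<tau>" for t \<tau> :: real
  define G where "G \<zeta> = g \<zeta> * exp (- of_real e * (of_real \<kappa> * \<zeta>\<^sup>2 - \<i> * of_real \<beta> * \<zeta>))" for \<zeta>
  have r0: "0 < r" using h by simp
  have \<kappa>0: "0 < \<kappa>" unfolding \<kappa>_def using r0 by simp
  have G_norm: "cmod (G (Complex t \<tau>)) = cmod (g (Complex t \<tau>)) * exp (- e * m t \<tau>)" for t \<tau>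
    by (simp add: G_def m_def norm_mult power2_eq_square algebra_simps)
  have m_lower: "\<kappa> * t\<^sup>2 + \<tau> / h \<le> m t \<tau>" if "0 \<le> \<tau>" "\<tau> \<le> h" for t \<tau>
  proof -
    have "m t \<tau> = \<kappa> * t\<^sup>2 + \<tau> / h + \<kappa> * \<tau> * (h - \<tau>)"
      by (simp add: m_def \<beta>_def power2_eq_square algebra_simps)
    moreover have "0 \<le> \<kappa> * \<tau> * (h - \<tau>)" using that \<kappa>0 by simp
    ultimately show ?thesis by linarith
  qed
  have holG: "G holomorphic_on UNIV"
    unfolding G_def by (intro holomorphic_intros hol)
  have "cmod (G (Complex 0 y)) \<le> 1"
  proof (rule maximum_modulus_frontier[where f = G and S = "cbox (Complex (- r) 0) (Complex r h)"])
    show "G holomorphic_on interior (cbox (Complex (- r) 0) (Complex r h))"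
      using holG by (rule holomorphic_on_subset) simp
    show "continuous_on (closure (cbox (Complex (- r) 0) (Complex r h))) G"
      by (intro holomorphic_on_imp_continuous_on holomorphic_on_subset[OF holG]) simp
    show "bounded (cbox (Complex (- r) 0) (Complex r h))" by simp
    show "Complex 0 y \<in> cbox (Complex (- r) 0) (Complex r h)"
      using r0 y by (simp add: in_cbox_complex_iff)
    fix z assume "z \<in> frontier (cbox (Complex (- r) 0) (Complex r h))"
    then have z: "z \<in> cbox (Complex (- r) 0) (Complex r h)" "z \<notin> box (Complex (- r) 0) (Complex r h)"
      by (simp_all add: frontier_cbox)
    define t \<tau> where "t = Re z" and "\<tau> = Im z"
    have zt: "z = Complex t \<tau>" by (simp add: t_def \<tau>_def)
    have bd: "\<bar>t\<bar> \<le> r" "0 \<le> \<tau>" "\<tau> \<le> h"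
      using z(1) by (auto simp: in_cbox_complex_iff t_def \<tau>_def)
    have "\<tau> = 0 \<or> 1 \<le> m t \<tau>"
    proof (cases "\<bar>t\<bar> = r")
      case True
      then have "t\<^sup>2 = r\<^sup>2" by (metis power2_abs)
      then have "\<kappa> * t\<^sup>2 = 2" using r0 by (simp add: \<kappa>_def)
      moreover have "0 \<le> \<tau> / h" using bd h by simp
      ultimately show ?thesis using m_lower[OF bd(2,3), of t] by linarith
    next
      case False
      then have "\<tau> = 0 \<or> \<tau> = h"
        using z(2) bd by (auto simp: in_box_complex_iff t_def \<tau>_def)
      moreover have "1 \<le> m t h"
      proof -
        have "0 \<le> \<kappa> * t\<^sup>2" using \<kappa>0 by simp
        then show ?thesis using m_lower[of h t] h by simp
      qed
      ultimately show ?thesis by auto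
    qed
    then show "cmod (G z) \<le> 1"
    proof
      assume \<tau>: "\<tau> = 0"
      have "0 \<le> m t 0" using \<kappa>0 by (simp add: m_def)
      then have "exp (- e * m t 0) \<le> 1" using e by simp
      then show ?thesis
        unfolding zt \<tau> G_norm using bottom[OF bd(1)] by (simp add: mult_le_one)
    next
      assume m1: "1 \<le> m t \<tau>"
      have "cmod (G z) \<le> exp e * exp (- e * m t \<tau>)"
        unfolding zt G_norm by (intro mult_right_mono rect bd) simp
      also have "\<dots> = exp (e - e * m t \<tau>)" by (simp flip: exp_add)
      also have "\<dots> \<le> 1" using mult_left_mono[OF m1 e] by simp
      finally show ?thesis .
    qed
  qed
  then have "cmod (g (Complex 0 y)) * exp (- e * m 0 y) \<le> 1" by (simp only: G_norm)
  then have "cmod (g (Complex 0 y)) \<le> exp (e * m 0 y)"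
    by (simp add: exp_minus divide_simps)
  also have "\<dots> \<le> exp (e * ((y / h) * (1 + 2 * h\<^sup>2 / r\<^sup>2)))"
  proof -
    have "m 0 y \<le> \<beta> * y" using \<kappa>0 by (simp add: m_def)
    also have "\<dots> = (y / h) * (1 + 2 * h\<^sup>2 / r\<^sup>2)"
      using h r0 by (simp add: \<beta>_def \<kappa>_def field_simps power2_eq_square)
    finally have "m 0 y \<le> (y / h) * (1 + 2 * h\<^sup>2 / r\<^sup>2)" .
    from mult_left_mono[OF this e] show ?thesis by (simp only: exp_le_cancel_iff)
  qed
  finally show ?thesis by (simp add: mult.assoc)
qed

text \<open>The Schwarz lemma applied to \<open>g - g 0\<close>, which is bounded by \<open>2 B\<close>; dividing by \<open>3 B\<close> makes the
  bound strict.\<close>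

lemma entire_lipschitz_at_zero:
  fixes g :: "complex \<Rightarrow> complex"
  assumes hol: "g holomorphic_on UNIV" and B: "0 < B"
    and bound: "\<And>\<zeta>. cmod \<zeta> \<le> R \<Longrightarrow> cmod (g \<zeta>) \<le> B"
    and \<zeta>: "cmod \<zeta> < R"
  shows "cmod (g \<zeta> - g 0) \<le> 3 * B * cmod \<zeta> / R"
proof -
  have R: "0 < R" using \<zeta> norm_ge_zero[of \<zeta>] by linarith
  define f where "f w = (g (of_real R * w) - g 0) / of_real (3 * B)" for w
  have "f holomorphic_on UNIV"
    unfolding f_def
    by (intro holomorphic_intros holomorphic_on_compose_gen[OF _ hol, unfolded o_def]) (use B in auto)
  then have holf: "f holomorphic_on ball 0 1" by (rule holomorphic_on_subset) simp
  have "cmod (f w) < 1" if "cmod w < 1" for w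
  proof -
    have "cmod (of_real R * w) \<le> R" using that R by (simp add: norm_mult)
    then have "cmod (g (of_real R * w) - g 0) \<le> B + B"
      using R by (intro order.trans[OF norm_triangle_ineq4] add_mono bound) auto
    then show ?thesis using B unfolding f_def norm_divide by (simp add: divide_simps)
  qed
  then have "cmod (f (\<zeta> / of_real R)) \<le> cmod (\<zeta> / of_real R)"
    using R \<zeta> by (intro Schwarz_Lemma(1)[OF holf]) (auto simp: f_def norm_divide)
  then show ?thesis
    using R B by (simp add: f_def norm_divide divide_simps norm_mult mult_ac)
qed

text \<open>The Bernstein--Walsh inequality for the disc, by the maximum principle for the reversed polynomial
  \<open>\<zeta> ^ k * P (1 / \<zeta>)\<close>.\<close>

lemma poly_growth_outside_disc:
  fixes P :: "complex poly"
  assumes deg: "degree P \<le> k"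
    and bound: "\<And>\<zeta>. cmod \<zeta> \<le> 1 \<Longrightarrow> cmod (poly P \<zeta>) \<le> B"
    and z: "1 \<le> cmod z"
  shows "cmod (poly P z) \<le> B * cmod z ^ k"
proof -
  define R where "R \<zeta> = (\<Sum>i\<le>k. coeff P i * \<zeta> ^ (k - i))" for \<zeta>
  have P_R: "poly P \<zeta> = \<zeta> ^ k * R (inverse \<zeta>)" if "\<zeta> \<noteq> 0" for \<zeta>
  proof -
    have "poly P \<zeta> = (\<Sum>i\<le>k. coeff P i * \<zeta> ^ i)"
      unfolding poly_altdef by (rule sum.mono_neutral_left) (use deg le_degree in auto)
    also have "\<dots> = \<zeta> ^ k * R (inverse \<zeta>)"
      unfolding R_def sum_distrib_left
    proof (rule sum.cong)
      fix i assume "i \<in> {..k}"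
      then have "\<zeta> ^ k = \<zeta> ^ i * \<zeta> ^ (k - i)" by (simp flip: power_add)
      then show "coeff P i * \<zeta> ^ i = \<zeta> ^ k * (coeff P i * inverse \<zeta> ^ (k - i))"
        using that by (simp add: power_inverse)
    qed simp
    finally show ?thesis .
  qed
  have holR: "R holomorphic_on UNIV" unfolding R_def by (intro holomorphic_intros)
  have "cmod (R (inverse z)) \<le> B"
  proof (rule maximum_modulus_frontier[where f = R and S = "cball 0 1"])
    show "R holomorphic_on interior (cball 0 1)" using holR by (rule holomorphic_on_subset) simp
    show "continuous_on (closure (cball 0 1)) R"
      by (intro holomorphic_on_imp_continuous_on holomorphic_on_subset[OF holR]) simp
    show "inverse z \<in> cball 0 1" using z by (simp add: norm_inverse inverse_le_1_iff)
    fix \<zeta> :: complex assume "\<zeta> \<in> frontier (cball 0 1)"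
    then have \<zeta>: "cmod \<zeta> = 1" by simp
    then have "\<zeta> \<noteq> 0" by auto
    then have "cmod (poly P (inverse \<zeta>)) = cmod (R \<zeta>)"
      using P_R[of "inverse \<zeta>"] \<zeta> by (simp add: norm_mult norm_power norm_inverse)
    then show "cmod (R \<zeta>) \<le> B" using bound[of "inverse \<zeta>"] \<zeta> by (simp add: norm_inverse)
  qed simp
  moreover have "z \<noteq> 0" using z by auto
  ultimately show ?thesis
    using P_R[of z] by (simp add: norm_mult norm_power mult.commute mult_right_mono)
qed

lemma polynomials_upto_on_line:
  assumes "s \<in> polynomials_upto k"
  obtains P where "degree P \<le> k" "\<And>\<zeta>. s (p + \<zeta> *s w) = poly P \<zeta>"
proof -
  obtain c where s: "s = (\<lambda>z. \<Sum>\<alpha> | (\<Sum>i\<in>UNIV. \<alpha> i) \<le> k. c \<alpha> * (\<Prod>i\<in>UNIV. (z $ i) ^ \<alpha> i))"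
    using assms by (auto simp: polynomials_upto_def)
  define P where
    "P = (\<Sum>\<alpha> | (\<Sum>i\<in>UNIV. \<alpha> i) \<le> k. smult (c \<alpha>) (\<Prod>i\<in>UNIV. [:p $ i, w $ i:] ^ \<alpha> i))"
  show thesis
  proof
    show "degree P \<le> k"
      unfolding P_def
    proof (intro degree_sum_le finite_multi_indices)
      fix \<alpha> :: "'a \<Rightarrow> nat" assume "\<alpha> \<in> {\<alpha>. (\<Sum>i\<in>UNIV. \<alpha> i) \<le> k}"
      then have \<alpha>: "(\<Sum>i\<in>UNIV. \<alpha> i) \<le> k" by simp
      have "degree (\<Prod>i\<in>UNIV. [:p $ i, w $ i:] ^ \<alpha> i) \<le> (\<Sum>i\<in>UNIV. degree ([:p $ i, w $ i:] ^ \<alpha> i))"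
        by (rule order.trans[OF degree_prod_sum_le]) (auto simp: o_def)
      also have "\<dots> \<le> (\<Sum>i\<in>UNIV. \<alpha> i)"
      proof (rule sum_mono)
        fix i
        show "degree ([:p $ i, w $ i:] ^ \<alpha> i) \<le> \<alpha> i"
          using degree_power_le[of "[:p $ i, w $ i:]" "\<alpha> i"]
          by (rule order.trans) (simp add: degree_pCons_eq_if)
      qed
      finally show "degree (smult (c \<alpha>) (\<Prod>i\<in>UNIV. [:p $ i, w $ i:] ^ \<alpha> i)) \<le> k"
        using \<alpha> degree_smult_le[of "c \<alpha>" "\<Prod>i\<in>UNIV. [:p $ i, w $ i:] ^ \<alpha> i"] by linarith
    qed
    show "s (p + \<zeta> *s w) = poly P \<zeta>" for \<zeta>
      by (simp add: s P_def poly_sum poly_prod)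
  qed
qed

lemma polynomials_upto_holomorphic_on_line:
  assumes "s \<in> polynomials_upto k"
  shows "(\<lambda>\<zeta>. s (p + \<zeta> *s w)) holomorphic_on UNIV"
proof -
  obtain P where "\<And>\<zeta>. s (p + \<zeta> *s w) = poly P \<zeta>"
    using polynomials_upto_on_line[OF assms] by blast
  then show ?thesis by (auto intro!: holomorphic_intros)
qed

lemma continuous_on_polynomials_upto:
  assumes "s \<in> polynomials_upto k"
  shows "continuous_on X s"
  using assms unfolding polynomials_upto_def by (auto intro!: continuous_intros)

lemma norm_vector_smult: "norm (c *s v) = cmod c * norm v" for v :: "complex ^ 'n"
  by (simp add: norm_vec_def norm_mult L2_set_right_distrib)

lemma dist_on_line: "dist (p + c *s v) p = cmod c * norm v" for v :: "complex ^ 'n"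
  by (simp add: dist_norm norm_vector_smult)

section \<open>Growth of polynomials near the submanifold\<close>

text \<open>The information about \<open>K\<close> and \<open>Q\<close> near \<open>p\<close> that the growth estimates use. Here \<open>L\<close> and \<open>l\<close> play the
  role of the derivatives of a parametrization \<open>\<phi>\<close> of \<open>K\<close> and of \<open>Q \<circ> \<phi>\<close> at the parameter of \<open>p\<close>. The
  decomposition of \<open>w\<close> expresses, with a quantitative constant, that the tangent space and its image
  under the complex structure span everything, and the last part is a first-order Taylor formula.\<close>

definition osculated ::
  "(complex ^ 'n) set \<Rightarrow> (complex ^ 'n \<Rightarrow> real) \<Rightarrow> real \<Rightarrow> real \<Rightarrow> real \<Rightarrow> complex ^ 'n \<Rightarrow> bool" where
  "osculated K Q \<delta> C \<rho> p \<longleftrightarrow>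
     (\<exists>(L :: real ^ 'n \<Rightarrow> complex ^ 'n) l :: real ^ 'n \<Rightarrow> real. linear L \<and> linear l \<and>
        (\<forall>w. \<exists>a b. w = L a + \<i> *s L b \<and> norm a \<le> C * norm w \<and> norm b \<le> C * norm w) \<and>
        (\<forall>h. norm h \<le> \<rho> \<longrightarrow> (\<exists>q\<in>K. norm (q - (p + L h)) \<le> C * norm h powr (1 + \<delta>) \<and>
                                \<bar>Q q - (Q p + l h)\<bar> \<le> C * norm h powr (1 + \<delta>))))"

text \<open>With \<open>u = ln \<bar>s\<bar> / k\<close> this says \<open>u z \<le> Q p + e\<close> whenever \<open>z\<close> is within distance \<open>d\<close> of \<open>p \<in> K\<close>. Stated for
  \<open>\<bar>s\<bar>\<close> it makes sense at the zeros of \<open>s\<close>.\<close>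

definition near_bound ::
  "'a::metric_space set \<Rightarrow> ('a \<Rightarrow> real) \<Rightarrow> nat \<Rightarrow> ('a \<Rightarrow> complex) \<Rightarrow> real \<Rightarrow> real \<Rightarrow> bool" where
  "near_bound K Q k s e d \<longleftrightarrow>
     (\<forall>p\<in>K. \<forall>z. dist z p \<le> d \<longrightarrow> cmod (s z) \<le> exp (real k * (Q p + e)))"

lemma near_boundD:
  "near_bound K Q k s e d \<Longrightarrow> p \<in> K \<Longrightarrow> dist z p \<le> d \<Longrightarrow> cmod (s z) \<le> exp (real k * (Q p + e))"
  by (auto simp: near_bound_def)

lemma near_bound_mono:
  assumes "near_bound K Q k s e d" "e \<le> e'" "d' \<le> d"
  shows "near_bound K Q k s e' d'"
  unfolding near_bound_def
proof (intro ballI allI impI)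
  fix p z assume "p \<in> K" "dist z p \<le> d'"
  then have "cmod (s z) \<le> exp (real k * (Q p + e))"
    using assms by (intro near_boundD[OF assms(1)]) auto
  also have "\<dots> \<le> exp (real k * (Q p + e'))" using assms by (simp add: mult_left_mono)
  finally show "cmod (s z) \<le> exp (real k * (Q p + e'))" .
qed

lemma polynomials_upto_lipschitz:
  assumes s: "s \<in> polynomials_upto k" and B: "0 < B"
    and bound: "\<And>z. dist z p \<le> R \<Longrightarrow> cmod (s z) \<le> B" and z: "dist z p < R"
  shows "cmod (s z - s p) \<le> 3 * B * dist z p / R"
proof (cases "z = p")
  case False
  define g where "g \<zeta> = s (p + \<zeta> *s (z - p))" for \<zeta>
  have d: "0 < dist z p" using False by simp
  have "cmod (g 1 - g 0) \<le> 3 * B * cmod 1 / (R / dist z p)"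
  proof (rule entire_lipschitz_at_zero[OF _ B])
    show "g holomorphic_on UNIV"
      unfolding g_def by (rule polynomials_upto_holomorphic_on_line[OF s])
    show "cmod (g \<zeta>) \<le> B" if "cmod \<zeta> \<le> R / dist z p" for \<zeta>
      unfolding g_def
    proof (rule bound)
      show "dist (p + \<zeta> *s (z - p)) p \<le> R"
        using that d unfolding dist_on_line by (simp add: dist_norm pos_le_divide_eq)
    qed
    show "cmod 1 < R / dist z p" using z d by (simp add: field_simps)
  qed
  then show ?thesis using d by (simp add: g_def field_simps)
qed simp

text \<open>Passing to a neighbourhood that is eight times larger costs only an additive constant, independent of
  the degree.\<close>

lemma near_bound_enlarge:
  assumes s: "s \<in> polynomials_upto k" and nb: "near_bound K Q k s e (d / 8)"
  shows "near_bound K Q k s (e + ln 8) d"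
  unfolding near_bound_def
proof (intro ballI allI impI)
  fix p z assume p: "p \<in> K" and z: "dist z p \<le> d"
  define w where "w = of_real (1 / 8) *s (z - p)"
  obtain P where P: "degree P \<le> k" "\<And>\<zeta>. s (p + \<zeta> *s w) = poly P \<zeta>"
    using polynomials_upto_on_line[OF s] by blast
  have w: "norm w \<le> d / 8"
    using z unfolding w_def norm_vector_smult by (simp add: dist_norm norm_divide)
  have "cmod (poly P \<zeta>) \<le> exp (real k * (Q p + e))" if "cmod \<zeta> \<le> 1" for \<zeta>
  proof -
    have "cmod \<zeta> * norm w \<le> 1 * norm w" using that by (intro mult_right_mono) auto
    then show ?thesis
      unfolding P(2)[symmetric] using w
      by (intro near_boundD[OF nb p]) (simp add: dist_norm norm_vector_smult)
  qed
  then have "cmod (poly P 8) \<le> exp (real k * (Q p + e)) * cmod 8 ^ k"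
    by (intro poly_growth_outside_disc[OF P(1)]) auto
  also have "poly P 8 = s z" unfolding P(2)[symmetric] by (simp add: w_def)
  also have "cmod 8 ^ k = exp (real k * ln 8)"
    by (simp add: exp_of_nat_mult)
  finally show "cmod (s z) \<le> exp (real k * (Q p + (e + ln 8)))"
    by (simp add: algebra_simps flip: exp_add)
qed

text \<open>The heart of the argument. Write \<open>z - p = L a + \<i> L b\<close> and consider the affine complex line
  \<open>\<zeta> \<mapsto> p + L a + (\<zeta> / d) L b\<close> with \<open>d = D / 2\<close>, which passes through \<open>z\<close> at \<open>\<zeta> = \<i> d\<close>. Since \<open>\<i> L b = (z - p) - L a\<close>,
  its point at \<open>\<zeta> = t + \<i> \<tau>\<close> is
  \<open>p + L (a + (t / d) b - (\<tau> / d) a) + (\<tau> / d) (z - p)\<close>, which is a point of the tangent plane plus a vector of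
  length at most \<open>\<tau>\<close>. The tangent plane osculates \<open>K\<close>, so the distance to \<open>K\<close> is at most \<open>\<tau>\<close> plus the
  osculation error \<open>E\<close>, with the constant in front of \<open>\<tau>\<close> equal to \<open>1\<close>, even though \<open>z - p\<close> may be far
  from orthogonal to \<open>K\<close>. The linear part of \<open>Q\<close> along the line is harmonic and vanishes at \<open>\<i> d\<close>, so it
  is removed by an exponential factor without any loss. The two-constants estimate then combines the
  bound \<open>Y\<close> on the bottom side, which lies within \<open>E\<close> of \<open>K\<close>, with the bound \<open>X\<close> on the whole rectangle,
  which lies within \<open>D\<close> of \<open>K\<close>.\<close>

lemma analytic_disc_estimate:
  fixes K :: "(complex ^ 'n) set"
  assumes s: "s \<in> polynomials_upto k" and osc: "osculated K Q \<delta> C \<rho> p" and p: "p \<in> K"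
    and pos: "0 < C" "0 < \<delta>" "0 < D" "0 < E" "0 \<le> X" "0 \<le> Y"
    and r: "2 * D \<le> r" "3 * C * r \<le> \<rho>"
    and E: "C * (3 * C * r) powr (1 + \<delta>) \<le> E" "2 * E \<le> D"
    and nbD: "near_bound K Q k s X D" and nbE: "near_bound K Q k s Y E"
    and z: "dist z p \<le> D / 2"
  shows "cmod (s z) \<le> exp (real k * (Q p + E + Y
           + X * ((D / 2) / (D - E)) * (1 + 2 * (D - E)\<^sup>2 / r\<^sup>2)))"
proof -
  define h where "h = D - E"
  define d where "d = D / 2"
  define w where "w = z - p"
  obtain L :: "real ^ 'n \<Rightarrow> complex ^ 'n" and l :: "real ^ 'n \<Rightarrow> real"
    where L: "linear L" and l: "linear l"
      and dec: "\<And>w. \<exists>a b. w = L a + \<i> *s L b \<and> norm a \<le> C * norm w \<and> norm b \<le> C * norm w"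
      and near: "\<And>v. norm v \<le> \<rho> \<Longrightarrow> \<exists>q\<in>K. norm (q - (p + L v)) \<le> C * norm v powr (1 + \<delta>) \<and>
                                \<bar>Q q - (Q p + l v)\<bar> \<le> C * norm v powr (1 + \<delta>)"
    using osc unfolding osculated_def by blast
  obtain a b where w: "w = L a + \<i> *s L b" and "norm a \<le> C * norm w" "norm b \<le> C * norm w"
    using dec by blast
  moreover have wd: "norm w \<le> d" using z by (simp add: w_def d_def dist_norm)
  ultimately have ab: "norm a \<le> C * d" "norm b \<le> C * d"
    using pos(1) by (meson mult_left_mono order.trans less_imp_le)+
  have d0: "0 < d" and dh: "d \<le> h" and h0: "0 < h" and hr: "2 * h \<le> r" and dr: "d \<le> r"
    using pos E r by (auto simp: d_def h_def)
  define v where "v t \<tau> = a + (t / d) *\<^sub>R b - (\<tau> / d) *\<^sub>R a" for t \<tau>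
  define f where "f \<zeta> = s ((p + L a) + \<zeta> *s (of_real (1 / d) *s L b))" for \<zeta>
  define H where "H \<zeta> = of_real (Q p + E + Y + l a) + \<zeta> * of_real (l b / d) + \<i> * \<zeta> * of_real (l a / d)"
    for \<zeta>
  define g where "g \<zeta> = f \<zeta> * exp (- of_real (real k) * H \<zeta>)" for \<zeta>
  have l_v: "l (v t \<tau>) = l a + (t / d) * l b - (\<tau> / d) * l a" for t \<tau>
    by (simp add: v_def linear_add[OF l] linear_diff[OF l] linear_scale[OF l])
  \<comment> \<open>\<open>Re H\<close> is the bound expected at the bottom: the first-order expansion of \<open>Q\<close> along the line
    plus all errors.\<close>
  have Re_H: "Re (H (Complex t \<tau>)) = Q p + E + Y + l (v t \<tau>)" for t \<tau>
    unfolding l_v by (simp add: H_def)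
  have g_norm: "cmod (g (Complex t \<tau>))
      = cmod (f (Complex t \<tau>)) * exp (- real k * (Q p + E + Y + l (v t \<tau>)))" for t \<tau>
    by (simp add: g_def norm_mult Re_H)
  have point: "(p + L a) + Complex t \<tau> *s (of_real (1 / d) *s L b)
      = p + L (v t \<tau>) + (\<tau> / d) *\<^sub>R w" for t \<tau>
  proof -
    have Lv: "L (v t \<tau>) = L a + (t / d) *\<^sub>R L b - (\<tau> / d) *\<^sub>R L a"
      by (simp add: v_def linear_add[OF L] linear_diff[OF L] linear_scale[OF L])
    show ?thesis
      unfolding Lv w vec_eq_iff complex_eq_iff using d0 by (simp add: field_simps)
  qed
  have near_K: "\<exists>q\<in>K. dist ((p + L a) + Complex t \<tau> *s (of_real (1 / d) *s L b)) q \<le> \<tau> + E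
                   \<and> Q q \<le> Q p + l (v t \<tau>) + E"
    if t: "\<bar>t\<bar> \<le> r" and \<tau>: "0 \<le> \<tau>" "\<tau> \<le> h" for t \<tau>
  proof -
    have "norm (v t \<tau>) \<le> norm a + norm ((t / d) *\<^sub>R b) + norm ((\<tau> / d) *\<^sub>R a)"
      unfolding v_def by (meson add_mono norm_triangle_ineq norm_triangle_ineq4 order.trans order_refl)
    also have "\<dots> \<le> C * r + C * r + C * r"
    proof (intro add_mono)
      show "norm a \<le> C * r" using ab(1) dr pos by (meson mult_left_mono order.trans less_imp_le)
      have "norm ((t / d) *\<^sub>R b) = (\<bar>t\<bar> / d) * norm b" using d0 by simp
      also have "\<dots> \<le> (\<bar>t\<bar> / d) * (C * d)" using ab(2) d0 by (intro mult_left_mono) auto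
      also have "\<dots> = C * \<bar>t\<bar>" using d0 by simp
      finally show "norm ((t / d) *\<^sub>R b) \<le> C * r" using t pos by (meson mult_left_mono order.trans less_imp_le)
      have "norm ((\<tau> / d) *\<^sub>R a) = (\<tau> / d) * norm a" using d0 \<tau> by simp
      also have "\<dots> \<le> (\<tau> / d) * (C * d)" using ab(1) d0 \<tau> by (intro mult_left_mono) auto
      also have "\<dots> = C * \<tau>" using d0 by simp
      also have "\<dots> \<le> C * r" using \<tau> hr h0 pos by (intro mult_left_mono) auto
      finally show "norm ((\<tau> / d) *\<^sub>R a) \<le> C * r" .
    qed
    finally have v: "norm (v t \<tau>) \<le> 3 * C * r" by simp
    then have "C * norm (v t \<tau>) powr (1 + \<delta>) \<le> C * (3 * C * r) powr (1 + \<delta>)"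
      using pos by (intro mult_left_mono powr_mono2) auto
    then have vE: "C * norm (v t \<tau>) powr (1 + \<delta>) \<le> E" using E(1) by linarith
    obtain q where q: "q \<in> K" "norm (q - (p + L (v t \<tau>))) \<le> E" "\<bar>Q q - (Q p + l (v t \<tau>))\<bar> \<le> E"
      using near[of "v t \<tau>"] v r(2) vE by (meson order.trans)
    have "norm ((\<tau> / d) *\<^sub>R w) = (\<tau> / d) * norm w" using d0 \<tau> by simp
    also have "\<dots> \<le> (\<tau> / d) * d" using wd d0 \<tau> by (intro mult_left_mono) auto
    finally have w\<tau>: "norm ((\<tau> / d) *\<^sub>R w) \<le> \<tau>" using d0 by simp
    have "dist (p + L (v t \<tau>) + (\<tau> / d) *\<^sub>R w) q = norm ((\<tau> / d) *\<^sub>R w - (q - (p + L (v t \<tau>))))"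
      by (simp add: dist_norm algebra_simps)
    also have "\<dots> \<le> \<tau> + E" using norm_triangle_ineq4 w\<tau> q(2) by (meson add_mono order.trans)
    finally show ?thesis using q unfolding point by (intro bexI[of _ q]) auto
  qed
  have "cmod (g (Complex 0 d)) \<le> exp ((real k * X) * (d / h) * (1 + 2 * h\<^sup>2 / r\<^sup>2))"
  proof (rule rectangle_two_constants[OF _ h0 hr])
    show "g holomorphic_on UNIV"
      unfolding g_def f_def H_def
      by (intro holomorphic_intros polynomials_upto_holomorphic_on_line[OF s])
    show "0 \<le> real k * X" "0 \<le> d" "d \<le> h" using pos d0 dh by auto
    fix t assume t: "\<bar>t\<bar> \<le> r"
    show "cmod (g (Complex t \<tau>)) \<le> exp (real k * X)" if \<tau>: "0 \<le> \<tau>" "\<tau> \<le> h" for \<tau>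
    proof -
      obtain q where q: "q \<in> K" "dist ((p + L a) + Complex t \<tau> *s (of_real (1 / d) *s L b)) q \<le> \<tau> + E"
          "Q q \<le> Q p + l (v t \<tau>) + E"
        using near_K[OF t \<tau>] by blast
      have "cmod (f (Complex t \<tau>)) \<le> exp (real k * (Q q + X))"
        unfolding f_def using q \<tau> by (intro near_boundD[OF nbD]) (auto simp: h_def)
      then have "cmod (g (Complex t \<tau>))
          \<le> exp (real k * (Q q + X)) * exp (- real k * (Q p + E + Y + l (v t \<tau>)))"
        unfolding g_norm by (rule mult_right_mono) simp
      also have "\<dots> = exp (real k * (Q q + X - (Q p + E + Y + l (v t \<tau>))))"
        by (simp add: algebra_simps flip: exp_add)
      also have "\<dots> \<le> exp (real k * X)"
        using q(3) pos by (simp add: mult_left_mono)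
      finally show ?thesis .
    qed
    show "cmod (g (Complex t 0)) \<le> 1"
    proof -
      obtain q where q: "q \<in> K" "dist ((p + L a) + Complex t 0 *s (of_real (1 / d) *s L b)) q \<le> 0 + E"
          "Q q \<le> Q p + l (v t 0) + E"
        using near_K[OF t, of 0] h0 by auto
      have "cmod (f (Complex t 0)) \<le> exp (real k * (Q q + Y))"
        unfolding f_def using q by (intro near_boundD[OF nbE]) auto
      then have "cmod (g (Complex t 0))
          \<le> exp (real k * (Q q + Y)) * exp (- real k * (Q p + E + Y + l (v t 0)))"
        unfolding g_norm by (rule mult_right_mono) simp
      also have "\<dots> = exp (real k * (Q q - (Q p + E + l (v t 0))))"
        by (simp add: algebra_simps flip: exp_add)
      also have "\<dots> \<le> 1"
        using q(3) by (simp add: mult_nonneg_nonpos)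
      finally show ?thesis .
    qed
  qed
  moreover have "v 0 d = 0" using d0 by (simp add: v_def)
  moreover have "f (Complex 0 d) = s z"
    unfolding f_def point using d0 \<open>v 0 d = 0\<close> by (simp add: linear_0[OF L] w_def)
  ultimately have "cmod (s z) * exp (- real k * (Q p + E + Y))
      \<le> exp ((real k * X) * (d / h) * (1 + 2 * h\<^sup>2 / r\<^sup>2))"
    by (simp add: g_norm linear_0[OF l])
  then have "cmod (s z) \<le> exp ((real k * X) * (d / h) * (1 + 2 * h\<^sup>2 / r\<^sup>2)) * exp (real k * (Q p + E + Y))"
    by (simp add: exp_minus divide_simps)
  also have "\<dots> = exp (real k * (Q p + E + Y + X * (d / h) * (1 + 2 * h\<^sup>2 / r\<^sup>2)))"
    unfolding exp_add[symmetric] by (rule arg_cong[where f = exp]) (simp add: algebra_simps)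
  finally show ?thesis unfolding h_def d_def .
qed

text \<open>One dyadic step. If \<open>e(d)\<close> denotes the best constant in \<open>near_bound\<close> at distance \<open>d\<close>, this says that
  \<open>e(d) / d\<close> grows by no more than a multiple of \<open>(1 + A) * D powr (\<delta> / 2)\<close> when \<open>d\<close> goes from \<open>D\<close> to \<open>D / 2\<close>,
  and these increments are summable over dyadic scales. The length \<open>r = D powr (1 - \<delta> / 4)\<close> of the disc is a compromise:
  it is much larger than \<open>D\<close>, so that the rectangle is flat (\<open>D\<^sup>2 / r\<^sup>2 = x\<close>), while the osculation error, of
  order \<open>r powr (1 + \<delta>)\<close>, is still at most a multiple of \<open>D * x\<close>.\<close>

lemma near_bound_halve:
  fixes K :: "(complex ^ 'n) set"
  assumes s: "s \<in> polynomials_upto k" and osc: "\<And>p. p \<in> K \<Longrightarrow> osculated K Q \<delta> C \<rho> p"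
    and \<delta>: "0 < \<delta>" "\<delta> \<le> 1" and C: "1 \<le> C" and D: "0 < D" "D \<le> 1"
    and x_def: "x = D powr (\<delta> / 2)" and C1_def: "C1 = C * (3 * C) powr (1 + \<delta>)"
    and small: "4 * C1 * x \<le> 1" "16 * x \<le> 1" "3 * C * x \<le> \<rho>"
    and A: "0 \<le> A" "\<And>d. 0 < d \<Longrightarrow> d \<le> D \<Longrightarrow> near_bound K Q k s (A * d) d"
    and a: "0 \<le> a" "near_bound K Q k s (a * D) D"
  shows "near_bound K Q k s ((a + (6 * C1 + 3) * (1 + A) * x) * (D / 2)) (D / 2)"
proof -
  \<comment> \<open>Taking the better of the two available bounds at scale \<open>D\<close> lets the relative error be measured
    by \<open>A\<close> alone.\<close>
  define a' where "a' = min a A"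
  define r where "r = D powr (1 - \<delta> / 4)"
  define E where "E = C1 * D * x"
  have a': "0 \<le> a'" "a' \<le> a" "a' \<le> A" "near_bound K Q k s (a' * D) D"
    using A(1) A(2)[of D] a D by (auto simp: a'_def min_def)
  have C1: "0 < C1" using C by (simp add: C1_def)
  have x0: "0 < x" using D by (simp add: x_def)
  have E0: "0 < E" using C1 D x0 by (simp add: E_def)
  have r0: "0 < r" using D by (simp add: r_def)
  have rD: "r * D powr (\<delta> / 4) = D"
    using D by (simp add: r_def flip: powr_add)
  have sq: "(D powr (\<delta> / 4))\<^sup>2 = x"
    using D by (simp add: x_def powr_powr flip: powr_realpow)
  have rx: "r\<^sup>2 * x = D\<^sup>2"
    unfolding sq[symmetric] using rD by (metis power_mult_distrib)
  have rr: "2 * D \<le> r"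
  proof -
    have "(2 * D)\<^sup>2 = r\<^sup>2 * (4 * x)" unfolding power_mult_distrib rx[symmetric] by simp
    also have "\<dots> \<le> r\<^sup>2 * 1" using small(2) x0 by (intro mult_left_mono) auto
    finally have "(2 * D)\<^sup>2 \<le> r\<^sup>2" by simp
    then show ?thesis by (rule power2_le_imp_le) (use r0 in simp)
  qed
  have r\<rho>: "3 * C * r \<le> \<rho>"
  proof -
    have "r \<le> x" unfolding r_def x_def using D \<delta> by (intro powr_mono') auto
    then have "3 * C * r \<le> 3 * C * x" using C by (intro mult_left_mono) auto
    then show ?thesis using small(3) by linarith
  qed
  have rE: "C * (3 * C * r) powr (1 + \<delta>) \<le> E"
  proof -
    have "r powr (1 + \<delta>) = D powr ((1 - \<delta> / 4) * (1 + \<delta>))" by (simp add: r_def powr_powr)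
    also have "\<dots> \<le> D powr (1 + \<delta> / 2)"
    proof (rule powr_mono')
      have "\<delta> * \<delta> \<le> \<delta> * 1" using \<delta> by (intro mult_left_mono) auto
      moreover have "(1 - \<delta> / 4) * (1 + \<delta>) = 1 + 3 / 4 * \<delta> - \<delta> * \<delta> / 4"
        by (simp add: field_simps)
      ultimately show "1 + \<delta> / 2 \<le> (1 - \<delta> / 4) * (1 + \<delta>)" using \<delta> by linarith
    qed (use D in auto)
    also have "\<dots> = D * x" using D by (simp add: powr_add x_def)
    finally have "C1 * r powr (1 + \<delta>) \<le> C1 * (D * x)" using C1 by (intro mult_left_mono) auto
    then show ?thesis using C r0 by (simp add: C1_def E_def powr_mult mult_ac)
  qed
  have C1x: "0 \<le> C1 * x" using C1 x0 by simp
  have ED: "2 * E \<le> D"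
  proof -
    have "D * (2 * (C1 * x)) \<le> D * 1" using small(1) D C1x by (intro mult_left_mono) linarith+
    then show ?thesis by (simp add: E_def mult_ac)
  qed
  have factor: "((D / 2) / (D - E)) * (1 + 2 * (D - E)\<^sup>2 / r\<^sup>2) \<le> (1 / 2) * (1 + (4 * C1 + 3) * x)"
  proof -
    have "D - E = D * (1 - C1 * x)" by (simp add: E_def algebra_simps)
    then have "(D / 2) / (D - E) = (1 / 2) * (1 / (1 - C1 * x))" using D by simp
    also have "1 / (1 - C1 * x) \<le> 1 + 2 * (C1 * x)"
    proof -
      have "C1 * x * (2 * (C1 * x)) \<le> C1 * x * 1" using small(1) C1x by (intro mult_left_mono) linarith+
      then show ?thesis using small(1) by (simp add: divide_le_eq algebra_simps)
    qed
    finally have 1: "(D / 2) / (D - E) \<le> (1 / 2) * (1 + 2 * (C1 * x))" by simp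
    have "(D - E)\<^sup>2 \<le> D\<^sup>2" using E0 ED by (intro power_mono) auto
    then have 2: "1 + 2 * (D - E)\<^sup>2 / r\<^sup>2 \<le> 1 + 2 * x" using r0 rx by (simp add: divide_le_eq mult_ac)
    have "((D / 2) / (D - E)) * (1 + 2 * (D - E)\<^sup>2 / r\<^sup>2) \<le> ((1 / 2) * (1 + 2 * (C1 * x))) * (1 + 2 * x)"
      using C1x by (intro mult_mono 1 2) auto
    also have "\<dots> = (1 / 2) * (1 + 2 * (C1 * x) + 2 * x + x * (4 * (C1 * x)))" by (simp add: algebra_simps)
    also have "x * (4 * (C1 * x)) \<le> x * 1" using small(1) x0 by (intro mult_left_mono) linarith+
    also have "(1 / 2) * (1 + 2 * (C1 * x) + 2 * x + x * 1) \<le> (1 / 2) * (1 + (4 * C1 + 3) * x)"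
      using C1x by (simp add: algebra_simps)
    finally show ?thesis by simp
  qed
  have total: "E + A * E + (a' * D) * (((D / 2) / (D - E)) * (1 + 2 * (D - E)\<^sup>2 / r\<^sup>2))
      \<le> (a + (6 * C1 + 3) * (1 + A) * x) * (D / 2)"
  proof -
    have "(a' * D) * (((D / 2) / (D - E)) * (1 + 2 * (D - E)\<^sup>2 / r\<^sup>2))
        \<le> (a' * D) * ((1 / 2) * (1 + (4 * C1 + 3) * x))"
      using a' D by (intro mult_left_mono factor) auto
    also have "\<dots> = (D / 2) * (a' + a' * ((4 * C1 + 3) * x))" by (simp add: algebra_simps)
    also have "\<dots> \<le> (D / 2) * (a + (1 + A) * ((4 * C1 + 3) * x))"
      using D a' C1 x0 by (intro mult_left_mono add_mono mult_right_mono) auto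
    finally have "(a' * D) * (((D / 2) / (D - E)) * (1 + 2 * (D - E)\<^sup>2 / r\<^sup>2))
        \<le> (D / 2) * (a + (1 + A) * ((4 * C1 + 3) * x))" .
    moreover have "E + A * E + (D / 2) * (a + (1 + A) * ((4 * C1 + 3) * x))
        = (a + (6 * C1 + 3) * (1 + A) * x) * (D / 2)"
      by (simp add: E_def field_simps)
    ultimately show ?thesis by linarith
  qed
  show ?thesis
    unfolding near_bound_def
  proof (intro ballI allI impI)
    fix p z assume p: "p \<in> K" and z: "dist z p \<le> D / 2"
    have "cmod (s z) \<le> exp (real k * (Q p + E + A * E
           + (a' * D) * ((D / 2) / (D - E)) * (1 + 2 * (D - E)\<^sup>2 / r\<^sup>2)))"
      by (rule analytic_disc_estimate[OF s osc[OF p] p _ _ _ _ _ _ rr r\<rho> rE ED a'(4) A(2) z])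
        (use C \<delta> D E0 a' A ED in auto)
    also have "\<dots> \<le> exp (real k * (Q p + (a + (6 * C1 + 3) * (1 + A) * x) * (D / 2)))"
      unfolding exp_le_cancel_iff using total by (intro mult_left_mono) (auto simp: mult.assoc)
    finally show "cmod (s z) \<le> exp (real k * (Q p + (a + (6 * C1 + 3) * (1 + A) * x) * (D / 2)))" .
  qed
qed

text \<open>A bound \<open>A * d\<close> valid at all scales up to \<open>d0\<close> improves itself to half of it plus a constant. One quarter
  of \<open>A\<close> comes from the largest scale: the bound at \<open>d0 / 8\<close> is \<open>A * d0 / 8\<close>, and enlarging back to \<open>d0\<close> costs
  \<open>ln 8\<close>. Another quarter, together with a constant, bounds the sum of the increments
  from the dyadic steps down to scale \<open>d\<close>, because \<open>d0\<close> is small.\<close>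

lemma near_bound_improve:
  fixes K :: "(complex ^ 'n) set"
  assumes s: "s \<in> polynomials_upto k" and osc: "\<And>p. p \<in> K \<Longrightarrow> osculated K Q \<delta> C \<rho> p"
    and \<delta>: "0 < \<delta>" "\<delta> \<le> 1" and C: "1 \<le> C" and d0: "0 < d0" "d0 \<le> 1"
    and x0_def: "x0 = d0 powr (\<delta> / 2)" and C1_def: "C1 = C * (3 * C) powr (1 + \<delta>)"
    and c_def: "c = 1 / (1 - 2 powr (- (\<delta> / 2)))"
    and small: "4 * C1 * x0 \<le> 1" "16 * x0 \<le> 1" "3 * C * x0 \<le> \<rho>" "c * (6 * C1 + 3) * x0 \<le> 1 / 4"
    and A: "0 \<le> A" "\<And>d. 0 < d \<Longrightarrow> d \<le> d0 \<Longrightarrow> near_bound K Q k s (A * d) d"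
    and d: "0 < d" "d \<le> d0"
  shows "near_bound K Q k s ((A / 2 + (2 * ln 8 / d0 + 1 / 4)) * d) d"
proof -
  define B where "B = 6 * C1 + 3"
  define a0 where "a0 = A / 4 + 2 * ln 8 / d0"
  \<comment> \<open>The term \<open>x0 - d powr (\<delta> / 2)\<close> is the closed form of the geometric sum of the increments; \<open>c\<close> is
    chosen such that halving \<open>d\<close> adds exactly one increment.\<close>
  define a where "a d = a0 + c * B * (1 + A) * (x0 - d powr (\<delta> / 2))" for d
  have C1: "0 < C1" using C by (simp add: C1_def)
  have "2 powr (- (\<delta> / 2)) < 2 powr (0::real)" using \<delta> by (intro powr_less_mono) auto
  then have c: "0 < c" "c * (1 - 2 powr (- (\<delta> / 2))) = 1" by (auto simp: c_def)
  have a0: "0 \<le> a0" using A d0 by (simp add: a0_def)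
  have cB: "0 \<le> c * B * (1 + A)" using c C1 A by (simp add: B_def)
  have le_x0: "d powr (\<delta> / 2) \<le> x0" if "0 < d" "d \<le> d0" for d
    unfolding x0_def using that \<delta> by (intro powr_mono2) auto
  have a_ge: "a0 \<le> a d" if "0 < d" "d \<le> d0" for d
    unfolding a_def using le_x0[OF that] cB by simp
  have top: "near_bound K Q k s (A * d0 / 8 + ln 8) d0"
    using near_bound_enlarge[OF s, of K Q "A * d0 / 8" d0] A(2)[of "d0 / 8"] d0 by simp
  have claim: "near_bound K Q k s (a d * d) d" if "d0 / 2 ^ n < d" "d \<le> d0" for n d
    using that
  proof (induction n arbitrary: d)
    case (Suc n)
    have d: "0 < d" using Suc.prems(1) d0 by (meson less_trans divide_pos_pos zero_less_power zero_less_numeral)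
    show ?case
    proof (cases "d0 / 2 < d")
      case True
      have "A * d0 / 8 + ln 8 = a0 * (d0 / 2)" using d0 by (simp add: a0_def field_simps)
      also have "\<dots> \<le> a d * d" using True a_ge[OF d Suc.prems(2)] a0 d0 by (intro mult_mono) auto
      finally show ?thesis using near_bound_mono[OF top] Suc.prems(2) by blast
    next
      case False
      define D where "D = 2 * d"
      have D: "0 < D" "D \<le> d0" "d0 / 2 ^ n < D" "d = D / 2"
        using d False Suc.prems by (auto simp: D_def field_simps)
      define x where "x = D powr (\<delta> / 2)"
      have x: "0 \<le> x" "x \<le> x0" using le_x0[OF D(1,2)] by (auto simp: x_def)
      have "near_bound K Q k s ((a D + B * (1 + A) * x) * (D / 2)) (D / 2)"
        unfolding B_def
      proof (rule near_bound_halve[OF s osc \<delta> C D(1) _ x_def C1_def])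
        show "D \<le> 1" using D d0 by simp
        have "4 * C1 * x \<le> 4 * C1 * x0" using x C1 by (intro mult_left_mono) auto
        then show "4 * C1 * x \<le> 1" using small(1) by linarith
        show "16 * x \<le> 1" using small(2) x by linarith
        have "3 * C * x \<le> 3 * C * x0" using x C by (intro mult_left_mono) auto
        then show "3 * C * x \<le> \<rho>" using small(3) by linarith
        show "0 \<le> A" by fact
        show "near_bound K Q k s (A * d) d" if "0 < d" "d \<le> D" for d
          using that D by (intro A(2)) auto
        show "0 \<le> a D" using a_ge[OF D(1,2)] a0 by linarith
        show "near_bound K Q k s (a D * D) D" using D by (intro Suc.IH) auto
      qed
      moreover have "a d = a D + B * (1 + A) * x"
      proof -
        have "d powr (\<delta> / 2) = D powr (\<delta> / 2) / 2 powr (\<delta> / 2)"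
          unfolding D(4) by (rule powr_divide)
        also have "\<dots> = 2 powr (- (\<delta> / 2)) * x" by (simp add: x_def powr_minus_divide)
        finally have "a d = a D + (c * (1 - 2 powr (- (\<delta> / 2)))) * (B * (1 + A) * x)"
          by (simp add: a_def x_def algebra_simps)
        then show ?thesis by (simp only: c mult_1)
      qed
      ultimately show ?thesis unfolding D(4)[symmetric] by simp
    qed
  qed simp
  obtain n where "d0 / d < 2 ^ n" using real_arch_pow[of 2 "d0 / d"] by auto
  then have "d0 / 2 ^ n < d" using d by (simp add: field_simps)
  from claim[OF this d(2)] show ?thesis
  proof (rule near_bound_mono)
    have "c * B * (1 + A) * (x0 - d powr (\<delta> / 2)) \<le> c * B * (1 + A) * x0"
      using cB by (intro mult_left_mono) auto
    also have "\<dots> = (c * (6 * C1 + 3) * x0) * (1 + A)" by (simp add: B_def)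
    also have "\<dots> \<le> (1 / 4) * (1 + A)" using small(4) A(1) by (intro mult_right_mono) auto
    finally have "a d \<le> A / 2 + (2 * ln 8 / d0 + 1 / 4)" by (simp add: a_def a0_def)
    then show "a d * d \<le> (A / 2 + (2 * ln 8 / d0 + 1 / 4)) * d"
      using d by (intro mult_right_mono) auto
  qed simp
qed

text \<open>A qualitative bound to start the iteration from. The constant depends on \<open>s\<close>; iterating
  the improvement step removes this dependence.\<close>

lemma near_bound_initial:
  fixes K :: "(complex ^ 'n) set"
  assumes s: "s \<in> polynomials_upto k" and k: "1 \<le> k" and K: "bounded K"
    and Q: "\<And>p. p \<in> K \<Longrightarrow> - M \<le> Q p"
    and sK: "\<And>p. p \<in> K \<Longrightarrow> cmod (s p) \<le> exp (real k * Q p)"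
  shows "\<exists>A\<ge>0. \<forall>d. 0 < d \<longrightarrow> d \<le> 1 \<longrightarrow> near_bound K Q k s (A * d) d"
proof -
  obtain R where R: "\<And>p. p \<in> K \<Longrightarrow> norm p \<le> R" using K by (auto simp: bounded_iff)
  have "bounded (s ` cball 0 (R + 2))"
    by (intro compact_imp_bounded compact_continuous_image continuous_on_polynomials_upto[OF s]) simp
  then obtain S where S: "0 < S" "\<And>z. norm z \<le> R + 2 \<Longrightarrow> cmod (s z) \<le> S"
    by (auto simp: bounded_pos)
  define A where "A = 3 / 2 * S * exp (real k * M)"
  have "near_bound K Q k s (A * d) d" if d: "0 < d" "d \<le> 1" for d
    unfolding near_bound_def
  proof (intro ballI allI impI)
    fix p z assume p: "p \<in> K" and z: "dist z p \<le> d"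
    have "cmod (s z - s p) \<le> 3 * S * dist z p / 2"
    proof (rule polynomials_upto_lipschitz[OF s S(1)])
      show "cmod (s z) \<le> S" if "dist z p \<le> 2" for z
        using that R[OF p] norm_triangle_sub[of z p] by (intro S(2)) (simp add: dist_norm)
    qed (use z d in auto)
    also have "\<dots> \<le> 3 * S * d / 2" using z S by (simp add: mult_left_mono divide_right_mono)
    also have "\<dots> = exp (- real k * M) * (A * d)"
      by (simp add: A_def exp_minus field_simps)
    also have "\<dots> \<le> exp (real k * Q p) * (A * d)"
      using mult_left_mono[OF Q[OF p], of "real k"] d S by (intro mult_right_mono) (auto simp: A_def)
    also have "\<dots> \<le> exp (real k * Q p) * (real k * (A * d))"
      using k d S mult_right_mono[of 1 "real k" "A * d"] by (intro mult_left_mono) (auto simp: A_def)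
    finally have "cmod (s z) \<le> exp (real k * Q p) * (1 + real k * (A * d))"
      using sK[OF p] norm_triangle_sub[of "s z" "s p"] by (simp add: algebra_simps)
    also have "\<dots> \<le> exp (real k * Q p) * exp (real k * (A * d))"
      by (intro mult_left_mono exp_ge_add_one_self) simp
    finally show "cmod (s z) \<le> exp (real k * (Q p + A * d))"
      by (simp add: algebra_simps exp_add)
  qed
  moreover have "0 \<le> A" using S by (simp add: A_def)
  ultimately show ?thesis by blast
qed

lemma exists_small_scale:
  fixes \<eta> \<epsilon> :: real
  assumes "0 < \<eta>" "0 < \<epsilon>"
  shows "\<exists>d. 0 < d \<and> d \<le> 1 \<and> d powr \<eta> \<le> \<epsilon>"
proof (intro exI conjI)
  define d where "d = (min 1 \<epsilon>) powr (1 / \<eta>)"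
  show "0 < d" using assms by (simp add: d_def)
  show "d \<le> 1" unfolding d_def using assms by (intro powr_le1) auto
  show "d powr \<eta> \<le> \<epsilon>" using assms by (simp add: d_def powr_powr)
qed

text \<open>The weighted Bernstein--Walsh inequality near \<open>K\<close> with a Lipschitz bound in the exponent. Iterating \<open>A \<mapsto> A / 2 + b\<close> from any starting value ends below \<open>2 * b + 1\<close>,
  which depends neither on \<open>k\<close> nor on \<open>s\<close>.\<close>

theorem near_bound_uniform:
  fixes K :: "(complex ^ 'n) set"
  assumes osc: "\<And>p. p \<in> K \<Longrightarrow> osculated K Q \<delta> C \<rho> p" and \<delta>: "0 < \<delta>" "\<delta> \<le> 1"
    and C: "1 \<le> C" and \<rho>: "0 < \<rho>" and K: "bounded K" and Q: "\<And>p. p \<in> K \<Longrightarrow> - M \<le> Q p"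
  obtains A d0 where "0 \<le> A" "0 < d0" "d0 \<le> 1"
    "\<And>k s d. 1 \<le> k \<Longrightarrow> s \<in> polynomials_upto k \<Longrightarrow>
        (\<And>p. p \<in> K \<Longrightarrow> cmod (s p) \<le> exp (real k * Q p)) \<Longrightarrow> 0 < d \<Longrightarrow> d \<le> d0 \<Longrightarrow>
        near_bound K Q k s (A * d) d"
proof -
  define C1 where "C1 = C * (3 * C) powr (1 + \<delta>)"
  define c where "c = 1 / (1 - 2 powr (- (\<delta> / 2)))"
  have "2 powr (- (\<delta> / 2)) < 2 powr (0::real)" using \<delta> by (intro powr_less_mono) auto
  then have c: "0 < c" by (simp add: c_def)
  have C1: "0 < C1" using C by (simp add: C1_def)
  define \<epsilon> where "\<epsilon> = Min {1 / (4 * C1), 1 / 16, \<rho> / (3 * C), 1 / (4 * (c * (6 * C1 + 3)))}"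
  have "0 < \<epsilon>" using C1 C c \<rho> by (simp add: \<epsilon>_def)
  then obtain d0 where d0: "0 < d0" "d0 \<le> 1" "d0 powr (\<delta> / 2) \<le> \<epsilon>"
    using exists_small_scale[of "\<delta> / 2" \<epsilon>] \<delta> by auto
  define x0 where "x0 = d0 powr (\<delta> / 2)"
  have "x0 \<le> 1 / (4 * C1)" "x0 \<le> 1 / 16" "x0 \<le> \<rho> / (3 * C)" "x0 \<le> 1 / (4 * (c * (6 * C1 + 3)))"
    using d0(3) by (auto simp: x0_def \<epsilon>_def)
  then have small: "4 * C1 * x0 \<le> 1" "16 * x0 \<le> 1" "3 * C * x0 \<le> \<rho>" "c * (6 * C1 + 3) * x0 \<le> 1 / 4"
    using C1 C c by (simp_all add: pos_le_divide_eq mult_ac)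
  define b where "b = 2 * ln 8 / d0 + 1 / 4"
  have b: "0 \<le> b" using d0 by (simp add: b_def)
  show thesis
  proof
    show "0 \<le> 2 * b + 1" using b by simp
    show "0 < d0" "d0 \<le> 1" by fact+
    fix k s d
    assume k: "1 \<le> k" and s: "s \<in> polynomials_upto k" and d: "0 < d" "d \<le> d0"
      and sK: "\<And>p. p \<in> K \<Longrightarrow> cmod (s p) \<le> exp (real k * Q p)"
    obtain A0 where A0: "0 \<le> A0" "\<And>d. 0 < d \<Longrightarrow> d \<le> 1 \<Longrightarrow> near_bound K Q k s (A0 * d) d"
      using near_bound_initial[OF s k K Q sK] by auto
    have iter: "0 < d \<Longrightarrow> d \<le> d0 \<Longrightarrow> near_bound K Q k s ((A0 / 2 ^ j + 2 * b) * d) d" for j d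
    proof (induction j arbitrary: d)
      case 0
      have "A0 * d \<le> (A0 / 2 ^ 0 + 2 * b) * d" using 0 b by (intro mult_right_mono) auto
      then show ?case using A0(2)[of d] 0 d0 near_bound_mono by (meson order.trans order_refl)
    next
      case (Suc j)
      have "near_bound K Q k s (((A0 / 2 ^ j + 2 * b) / 2 + b) * d) d"
        unfolding b_def
        by (rule near_bound_improve[OF s osc \<delta> C d0(1,2) x0_def C1_def c_def small])
          (use Suc A0(1) b in \<open>auto simp: b_def\<close>)
      then show ?case by (simp add: add_divide_distrib mult.commute add.commute)
    qed
    obtain j where j: "A0 < 2 ^ j" using real_arch_pow[of 2 A0] by auto
    show "near_bound K Q k s ((2 * b + 1) * d) d"
    proof (rule near_bound_mono[OF iter[OF d, of j]])
      show "(A0 / 2 ^ j + 2 * b) * d \<le> (2 * b + 1) * d"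
        using j d by (intro mult_right_mono) (auto simp: field_simps)
    qed simp
  qed
qed

section \<open>Tangent spaces and Taylor estimates in local parametrizations\<close>

lemma Ck_on_Suc_imp: "Ck_on (Suc r) f U \<Longrightarrow> Ck_on r f U"
proof (induction r arbitrary: f)
  case 0
  then show ?case
    by (auto intro!: continuous_at_imp_continuous_on differentiable_imp_continuous_within)
next
  case (Suc r)
  then show ?case by (metis Ck_on.simps(2))
qed

lemma Ck_on_le: "Ck_on m f U \<Longrightarrow> r \<le> m \<Longrightarrow> Ck_on r f U"
proof (induction m)
  case (Suc m)
  then show ?case using Ck_on_Suc_imp by (metis le_Suc_eq)
qed simp

lemma linear_frechet_derivative:
  "f differentiable (at u) \<Longrightarrow> linear (frechet_derivative f (at u))"
  by (simp add: frechet_derivative_works has_derivative_linear)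

lemma linear_norm_le_basis:
  fixes f :: "'a::euclidean_space \<Rightarrow> 'b::real_normed_vector"
  assumes f: "linear f" and B: "\<And>b. b \<in> Basis \<Longrightarrow> norm (f b) \<le> B"
  shows "norm (f v) \<le> real DIM('a) * B * norm v"
proof -
  have "f v = f (\<Sum>b\<in>Basis. (v \<bullet> b) *\<^sub>R b)" by (simp add: euclidean_representation)
  also have "\<dots> = (\<Sum>b\<in>Basis. (v \<bullet> b) *\<^sub>R f b)" by (simp add: linear_sum[OF f] linear_scale[OF f])
  also have "norm \<dots> \<le> (\<Sum>b\<in>(Basis :: 'a set). norm v * B)"
    by (rule order.trans[OF norm_sum sum_mono]) (auto intro!: mult_mono B Basis_le_norm)
  finally show ?thesis by (simp add: mult_ac)
qed

lemma C1_lipschitz_on_compact_convex: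
  fixes f :: "'a::euclidean_space \<Rightarrow> 'b::real_normed_vector"
  assumes f: "Ck_on 1 f U" and S: "compact S" "convex S" "S \<subseteq> U"
  shows "\<exists>M\<ge>0. \<forall>x\<in>S. \<forall>y\<in>S. norm (f x - f y) \<le> M * norm (x - y)"
proof -
  have diff: "f differentiable (at x)" if "x \<in> S" for x using f S that by auto
  have "\<exists>M. \<forall>x\<in>S. norm (frechet_derivative f (at x) b) \<le> M" for b
  proof -
    have "continuous_on S (\<lambda>x. frechet_derivative f (at x) b)"
      using f S(3) by (auto intro: continuous_on_subset)
    then have "bounded ((\<lambda>x. frechet_derivative f (at x) b) ` S)"
      using S(1) by (intro compact_imp_bounded compact_continuous_image)
    then show ?thesis by (auto simp: bounded_iff)
  qed
  then obtain M where M: "\<And>b x. x \<in> S \<Longrightarrow> norm (frechet_derivative f (at x) b) \<le> M b" by metis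
  define N where "N = (\<Sum>b\<in>Basis. \<bar>M b\<bar>)"
  have N: "M b \<le> N" if "b \<in> Basis" for b
    using member_le_sum[of b Basis "\<lambda>b. \<bar>M b\<bar>"] that by (auto simp: N_def)
  have N0: "0 \<le> N" by (simp add: N_def sum_nonneg)
  have "norm (f x - f y) \<le> (real DIM('a) * N) * norm (x - y)" if xy: "x \<in> S" "y \<in> S" for x y
  proof (rule differentiable_bound[OF S(2) _ _ xy])
    show "(f has_derivative frechet_derivative f (at z)) (at z within S)" if "z \<in> S" for z
      using diff[OF that] by (simp add: frechet_derivative_works has_derivative_at_withinI)
    show "onorm (frechet_derivative f (at z)) \<le> real DIM('a) * N" if "z \<in> S" for z
      using M[OF that] N
      by (intro onorm_le linear_norm_le_basis linear_frechet_derivative diff that) (blast intro: order.trans)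
  qed
  then show ?thesis using N0 by (intro exI[of _ "real DIM('a) * N"]) auto
qed

text \<open>The Hoelder condition is imposed on the directional derivatives along a basis only, which is the
  form in which it is available for maps of class \<open>C\<^sup>2\<close> and for the weight.\<close>

lemma hoelder_taylor:
  fixes f :: "'a::euclidean_space \<Rightarrow> 'b::real_normed_vector"
  assumes S: "convex S" and diff: "\<And>x. x \<in> S \<Longrightarrow> f differentiable (at x)"
    and hoelder: "\<And>b x y. b \<in> Basis \<Longrightarrow> x \<in> S \<Longrightarrow> y \<in> S \<Longrightarrow>
      norm (frechet_derivative f (at x) b - frechet_derivative f (at y) b) \<le> M * dist x y powr \<delta>"
    and M: "0 \<le> M" and \<delta>: "0 < \<delta>" and xy: "x \<in> S" "y \<in> S"
  shows "norm (f y - f x - frechet_derivative f (at x) (y - x))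
    \<le> real DIM('a) * M * norm (y - x) powr (1 + \<delta>)"
proof -
  have seg: "closed_segment x y \<subseteq> S" using S xy by (simp add: closed_segment_subset)
  have "norm (f y - f x - frechet_derivative f (at x) (y - x))
    \<le> norm (y - x) * (real DIM('a) * (M * norm (y - x) powr \<delta>))"
  proof (rule differentiable_bound_linearization)
    show "x + t *\<^sub>R (y - x) \<in> closed_segment x y" if "t \<in> {0..1}" for t
      using that by (auto simp: in_segment algebra_simps intro!: exI[of _ t])
    show "x \<in> closed_segment x y" by simp
    fix z assume z: "z \<in> closed_segment x y"
    then have zS: "z \<in> S" using seg by auto
    show "(f has_derivative frechet_derivative f (at z)) (at z within closed_segment x y)"
      using diff[OF zS] by (simp add: frechet_derivative_works has_derivative_at_withinI)
    have "linear (frechet_derivative f (at z) - frechet_derivative f (at x))"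
      unfolding fun_diff_def
      by (intro linear_compose_sub linear_frechet_derivative diff zS xy)
    moreover have "norm ((frechet_derivative f (at z) - frechet_derivative f (at x)) b)
        \<le> M * norm (y - x) powr \<delta>" if "b \<in> Basis" for b
    proof -
      have "dist z x \<le> norm (y - x)"
        using segment_bound(1)[OF z] by (simp add: dist_norm)
      then have "M * dist z x powr \<delta> \<le> M * norm (y - x) powr \<delta>"
        using M \<delta> by (intro mult_left_mono powr_mono2) auto
      then show ?thesis using hoelder[OF that zS xy(1)] by (simp add: fun_diff_def)
    qed
    ultimately show "onorm (frechet_derivative f (at z) - frechet_derivative f (at x))
        \<le> real DIM('a) * (M * norm (y - x) powr \<delta>)"
      by (intro onorm_le linear_norm_le_basis)
  qed
  also have "\<dots> = real DIM('a) * M * (norm (y - x) * norm (y - x) powr \<delta>)" by simp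
  also have "norm (y - x) * norm (y - x) powr \<delta> = norm (y - x) powr (1 + \<delta>)"
    by (cases "y = x") (auto simp: powr_add)
  finally show ?thesis .
qed

text \<open>For the inclusion from left to right, let \<open>\<gamma>\<close> be a curve in \<open>K\<close> through \<open>\<phi> u\<close>. As \<open>\<phi>\<close> is a homeomorphism
  onto an open part of \<open>K\<close>, the curve lifts to a continuous curve \<open>\<psi> \<circ> \<gamma>\<close> of parameters, and since the
  derivative \<open>L\<close> of \<open>\<phi>\<close> is bounded below, the lift moves at most linearly in \<open>t\<close>. Hence
  \<open>L ((\<psi> (\<gamma> t) - u) / t)\<close> approximates the velocity of \<open>\<gamma>\<close>, which therefore belongs to the closed
  subspace \<open>range L\<close>.\<close>

lemma tangent_space_local_param:
  fixes \<phi> :: "real ^ 'd \<Rightarrow> 'a::euclidean_space"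
  assumes lp: "local_param r K U \<phi>" and r: "1 \<le> r" and u: "u \<in> U"
  shows "tangent_space K (\<phi> u) = range (frechet_derivative \<phi> (at u))"
proof
  define L where "L = frechet_derivative \<phi> (at u)"
  obtain \<psi> where U: "open U" and Ck: "Ck_on 1 \<phi> U" and inj: "inj L"
    and op: "openin (top_of_set K) (\<phi> ` U)" and hom: "homeomorphism U (\<phi> ` U) \<phi> \<psi>"
    using lp r u Ck_on_le[of r \<phi> U 1] by (auto simp: local_param_def L_def)
  have der: "(\<phi> has_derivative L) (at u)"
    using Ck u by (simp add: L_def frechet_derivative_works)
  have L: "linear L" using der has_derivative_linear by blast
  show "tangent_space K (\<phi> u) \<subseteq> range (frechet_derivative \<phi> (at u))"
  proof
    fix v assume "v \<in> tangent_space K (\<phi> u)"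
    then obtain \<gamma> :: "real \<Rightarrow> 'a" and e where e: "e > 0"
      and \<gamma>K: "\<gamma> ` {-e<..<e} \<subseteq> K" and \<gamma>0: "\<gamma> 0 = \<phi> u" and \<gamma>': "(\<gamma> has_vector_derivative v) (at 0)"
      by (auto simp: tangent_space_def)
    obtain B where B: "B > 0" "\<And>h. B * norm h \<le> norm (L h)"
      using linear_inj_bounded_below_pos[OF L inj] by blast
    obtain T where T: "open T" "\<phi> ` U = K \<inter> T" using op by (auto simp: openin_open)
    have \<gamma>cont: "continuous (at 0) \<gamma>" using \<gamma>' by (rule has_vector_derivative_continuous)
    have \<gamma>lim: "(\<gamma> \<longlongrightarrow> \<phi> u) (at 0)" using \<gamma>cont unfolding continuous_at \<gamma>0 .
    have ev_T: "\<forall>\<^sub>F t in at 0. \<gamma> t \<in> \<phi> ` U"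
    proof -
      have "\<phi> u \<in> T" using T(2) u by blast
      then have "\<forall>\<^sub>F t in at 0. \<gamma> t \<in> T" by (rule topological_tendstoD[OF \<gamma>lim T(1)])
      moreover have "\<forall>\<^sub>F t in at 0. t \<in> {-e<..<e}"
        using e by (intro eventually_at_in_open') auto
      ultimately show ?thesis by eventually_elim (use \<gamma>K T in blast)
    qed
    have x_lim: "((\<lambda>t. \<psi> (\<gamma> t)) \<longlongrightarrow> u) (at 0)"
    proof -
      have \<psi>: "continuous_on (\<phi> ` U) \<psi>" "\<psi> (\<phi> u) = u" using hom u by (auto simp: homeomorphism_def)
      have "((\<lambda>t. \<psi> (\<gamma> t)) \<longlongrightarrow> \<psi> (\<phi> u)) (at 0)"
        by (rule continuous_on_tendsto_compose[OF \<psi>(1) \<gamma>lim _ ev_T]) (use u in blast)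
      then show ?thesis unfolding \<psi>(2) .
    qed
    have "v \<in> closure (range L)"
      unfolding closure_approachable
    proof (intro allI impI)
      fix \<eta> :: real assume \<eta>: "\<eta> > 0"
      define \<epsilon> where "\<epsilon> = min (B / 2) (\<eta> * B / (8 * (norm v + 1)))"
      have \<epsilon>: "0 < \<epsilon>" "\<epsilon> \<le> B / 2" "\<epsilon> * (2 * (norm v + 1) / B) \<le> \<eta> / 4"
      proof -
        show "0 < \<epsilon>" using B(1) \<eta> norm_ge_zero[of v] by (auto simp: \<epsilon>_def add_nonneg_pos)
        show "\<epsilon> \<le> B / 2" unfolding \<epsilon>_def by (rule min.cobounded1)
        have "\<epsilon> * (2 * (norm v + 1) / B) \<le> (\<eta> * B / (8 * (norm v + 1))) * (2 * (norm v + 1) / B)"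
          using B(1) by (intro mult_right_mono) (auto simp: \<epsilon>_def)
        also have "\<dots> = \<eta> / 4"
        proof -
          have "(\<eta> * B / (8 * n)) * (2 * n / B) = \<eta> / 4" if "n \<noteq> 0" for n
            using B(1) that by (simp add: field_simps)
          moreover have "norm v + 1 \<noteq> 0" using norm_ge_zero[of v] by linarith
          ultimately show ?thesis by blast
        qed
        finally show "\<epsilon> * (2 * (norm v + 1) / B) \<le> \<eta> / 4" .
      qed
      obtain d where d: "d > 0"
        "\<And>y. norm (y - u) < d \<Longrightarrow> norm (\<phi> y - \<phi> u - L (y - u)) \<le> \<epsilon> * norm (y - u)"
        using der \<epsilon>(1) unfolding has_derivative_at_alt by blast
      define \<epsilon>' where "\<epsilon>' = min 1 (\<eta> / 4)"
      have \<epsilon>': "\<epsilon>' > 0" using \<eta> by (simp add: \<epsilon>'_def)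
      obtain d' where d': "d' > 0"
        "\<And>t. norm (t - 0) < d' \<Longrightarrow> norm (\<gamma> t - \<gamma> 0 - (t - 0) *\<^sub>R v) \<le> \<epsilon>' * norm (t - 0)"
        using \<gamma>' \<epsilon>' unfolding has_vector_derivative_def has_derivative_at_alt by blast
      have "\<forall>\<^sub>F t in at 0. norm (\<psi> (\<gamma> t) - u) < d"
        using x_lim d(1) by (simp add: tendsto_iff dist_norm)
      moreover have "\<forall>\<^sub>F t in at (0::real). t \<in> {-d'<..<d'}"
        using d' by (intro eventually_at_in_open') auto
      moreover have "\<forall>\<^sub>F t in at (0::real). t \<noteq> 0" by (simp add: eventually_at_filter)
      ultimately have "\<forall>\<^sub>F t in at 0. t \<noteq> 0 \<and> \<bar>t\<bar> < d' \<and> norm (\<psi> (\<gamma> t) - u) < d \<and> \<gamma> t \<in> \<phi> ` U"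
        using ev_T by eventually_elim auto
      then have "\<exists>t. t \<noteq> 0 \<and> \<bar>t\<bar> < d' \<and> norm (\<psi> (\<gamma> t) - u) < d \<and> \<gamma> t \<in> \<phi> ` U"
        by (rule eventually_happens'[rotated]) simp
      then obtain t where t: "t \<noteq> 0" "\<bar>t\<bar> < d'" "norm (\<psi> (\<gamma> t) - u) < d" "\<gamma> t \<in> \<phi> ` U"
        by blast
      define h where "h = \<psi> (\<gamma> t) - u"
      have \<phi>\<psi>: "\<phi> (\<psi> (\<gamma> t)) = \<gamma> t" using hom t(4) by (auto simp: homeomorphism_def)
      have F: "norm (\<gamma> t - \<phi> u - L h) \<le> \<epsilon> * norm h" using d(2)[OF t(3)] by (simp add: \<phi>\<psi> h_def)
      have G: "norm (\<gamma> t - \<phi> u - t *\<^sub>R v) \<le> \<epsilon>' * \<bar>t\<bar>" using d'(2)[of t] t(2) by (simp add: \<gamma>0)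
      have G': "norm (\<gamma> t - \<phi> u) \<le> (norm v + 1) * \<bar>t\<bar>"
      proof -
        have "norm (\<gamma> t - \<phi> u) \<le> norm (t *\<^sub>R v) + norm (\<gamma> t - \<phi> u - t *\<^sub>R v)"
          by (rule norm_triangle_sub)
        also have "\<dots> \<le> \<bar>t\<bar> * norm v + 1 * \<bar>t\<bar>"
          using G by (intro add_mono order.trans[OF G] mult_right_mono) (auto simp: \<epsilon>'_def)
        finally show ?thesis by (simp add: algebra_simps)
      qed
      have h: "norm h \<le> (2 * (norm v + 1) / B) * \<bar>t\<bar>"
      proof -
        have "B * norm h \<le> norm (L h)" by (rule B)
        also have "\<dots> \<le> norm (\<gamma> t - \<phi> u) + norm (\<gamma> t - \<phi> u - L h)"
          by (metis norm_minus_commute norm_triangle_sub)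
        also have "\<dots> \<le> (norm v + 1) * \<bar>t\<bar> + (B / 2) * norm h"
          using G' F \<epsilon>(2) by (intro add_mono order.trans[OF F] mult_right_mono) auto
        finally have "(B / 2) * norm h \<le> (norm v + 1) * \<bar>t\<bar>" by simp
        then show ?thesis using B(1) by (simp add: field_simps)
      qed
      have "norm (t *\<^sub>R v - L h) \<le> norm (\<gamma> t - \<phi> u - L h) + norm (\<gamma> t - \<phi> u - t *\<^sub>R v)"
        using norm_triangle_ineq4[of "\<gamma> t - \<phi> u - L h" "\<gamma> t - \<phi> u - t *\<^sub>R v"] by simp
      also have "\<dots> \<le> \<epsilon> * norm h + \<epsilon>' * \<bar>t\<bar>" using F G by (rule add_mono)
      also have "\<dots> \<le> (\<eta> / 4) * \<bar>t\<bar> + (\<eta> / 4) * \<bar>t\<bar>"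
      proof (intro add_mono mult_right_mono)
        have "\<epsilon> * norm h \<le> \<epsilon> * (2 * (norm v + 1) / B) * \<bar>t\<bar>"
          using mult_left_mono[OF h, of \<epsilon>] \<epsilon>(1) by (simp add: mult_ac)
        also have "\<dots> \<le> (\<eta> / 4) * \<bar>t\<bar>" using \<epsilon>(3) by (intro mult_right_mono) auto
        finally show "\<epsilon> * norm h \<le> (\<eta> / 4) * \<bar>t\<bar>" .
      qed (auto simp: \<epsilon>'_def)
      also have "\<dots> < \<eta> * \<bar>t\<bar>" using \<eta> t(1) by simp
      finally have 1: "norm (t *\<^sub>R v - L h) < \<eta> * \<bar>t\<bar>" .
      have "t *\<^sub>R (v - L ((1 / t) *\<^sub>R h)) = t *\<^sub>R v - L h"
        using t(1) by (simp add: linear_scale[OF L] scaleR_diff_right)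
      then have "\<bar>t\<bar> * norm (v - L ((1 / t) *\<^sub>R h)) < \<bar>t\<bar> * \<eta>"
        using 1 by (metis norm_scaleR mult.commute)
      then have "dist (L ((1 / t) *\<^sub>R h)) v < \<eta>"
        using t(1) by (simp add: dist_norm norm_minus_commute)
      then show "\<exists>y\<in>range L. dist y v < \<eta>" by blast
    qed
    moreover have "closed (range L)"
      by (intro closed_subspace linear_subspace_image[OF L]) simp
    ultimately show "v \<in> range (frechet_derivative \<phi> (at u))"
      by (simp add: L_def)
  qed
  show "range (frechet_derivative \<phi> (at u)) \<subseteq> tangent_space K (\<phi> u)"
  proof
    fix w assume "w \<in> range (frechet_derivative \<phi> (at u))"
    then obtain v where w: "w = L v" by (auto simp: L_def)
    obtain R where R: "R > 0" "ball u R \<subseteq> U" using U u open_contains_ball by blast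
    define e where "e = R / (norm v + 1)"
    have nv: "norm v + 1 > 0" using norm_ge_zero[of v] by linarith
    have e: "e > 0" using R nv by (simp add: e_def)
    define \<gamma> where "\<gamma> t = \<phi> (u + t *\<^sub>R v)" for t
    have in_U: "u + t *\<^sub>R v \<in> U" if "t \<in> {-e<..<e}" for t
    proof -
      have "\<bar>t\<bar> * norm v \<le> \<bar>t\<bar> * (norm v + 1)" by (intro mult_left_mono) auto
      also have "\<dots> < e * (norm v + 1)" using that nv by (intro mult_strict_right_mono) auto
      also have "\<dots> = R" using nv by (simp add: e_def)
      finally show ?thesis using R(2) by (auto simp: dist_norm)
    qed
    have der\<gamma>: "(\<gamma> has_vector_derivative frechet_derivative \<phi> (at (u + t *\<^sub>R v)) v) (at t)"
      if t: "t \<in> {-e<..<e}" for t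
    proof -
      have "(\<phi> has_derivative frechet_derivative \<phi> (at (u + t *\<^sub>R v))) (at (u + t *\<^sub>R v))"
        using Ck in_U[OF t] by (simp flip: frechet_derivative_works)
      moreover have "((\<lambda>t. u + t *\<^sub>R v) has_vector_derivative v) (at t)"
        by (auto intro!: derivative_eq_intros)
      ultimately show ?thesis
        unfolding \<gamma>_def using vector_derivative_diff_chain_within[of "\<lambda>t. u + t *\<^sub>R v" v t UNIV \<phi>]
        by (simp add: o_def has_derivative_at_withinI)
    qed
    have "Ck_on 1 \<gamma> {-e<..<e}"
    proof -
      have fd: "frechet_derivative \<gamma> (at t) h = h *\<^sub>R frechet_derivative \<phi> (at (u + t *\<^sub>R v)) v"
        if "t \<in> {-e<..<e}" for t h
        using der\<gamma>[OF that] unfolding has_vector_derivative_def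
        by (metis frechet_derivative_at)
      have cont: "continuous_on {-e<..<e} (\<lambda>t. h *\<^sub>R frechet_derivative \<phi> (at (u + t *\<^sub>R v)) v)" for h
      proof (intro continuous_intros)
        have "continuous_on U (\<lambda>y. frechet_derivative \<phi> (at y) v)" using Ck by simp
        then show "continuous_on {-e<..<e} (\<lambda>t. frechet_derivative \<phi> (at (u + t *\<^sub>R v)) v)"
          by (rule continuous_on_compose2) (auto intro!: continuous_intros in_U)
      qed
      show ?thesis
        unfolding One_nat_def Ck_on.simps
      proof (intro conjI ballI allI)
        show "\<gamma> differentiable (at t)" if "t \<in> {-e<..<e}" for t
          using der\<gamma>[OF that] unfolding differentiable_def has_vector_derivative_def by blast
        show "continuous_on {-e<..<e} (\<lambda>t. frechet_derivative \<gamma> (at t) h)" for h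
          by (subst continuous_on_cong[OF refl fd]) (auto intro: cont)
      qed
    qed
    moreover have "\<gamma> ` {-e<..<e} \<subseteq> K"
      using in_U openin_imp_subset[OF op] by (auto simp: \<gamma>_def)
    moreover have "\<gamma> 0 = \<phi> u" by (simp add: \<gamma>_def)
    moreover have "(\<gamma> has_vector_derivative w) (at 0)" using der\<gamma>[of 0] e by (simp add: w L_def)
    ultimately show "w \<in> tangent_space K (\<phi> u)" using e unfolding tangent_space_def by blast
  qed
qed

definition hoelder_derivative_on ::
  "real \<Rightarrow> real \<Rightarrow> ('a::euclidean_space \<Rightarrow> 'b::real_normed_vector) \<Rightarrow> 'a set \<Rightarrow> bool" where
  "hoelder_derivative_on M \<delta> f S \<longleftrightarrow>
     (\<forall>x\<in>S. f differentiable (at x)) \<and>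
     (\<forall>b\<in>Basis. \<forall>x\<in>S. \<forall>y\<in>S.
        norm (frechet_derivative f (at x) b - frechet_derivative f (at y) b) \<le> M * dist x y powr \<delta>)"

lemma hoelder_derivative_close:
  fixes f :: "'a::euclidean_space \<Rightarrow> 'b::real_normed_vector"
  assumes f: "hoelder_derivative_on M \<delta> f S" and xy: "x \<in> S" "y \<in> S"
  shows "norm (frechet_derivative f (at x) v - frechet_derivative f (at y) v)
    \<le> real DIM('a) * (M * dist x y powr \<delta>) * norm v"
proof -
  have "linear (\<lambda>v. frechet_derivative f (at x) v - frechet_derivative f (at y) v)"
    using f xy by (intro linear_compose_sub linear_frechet_derivative) (auto simp: hoelder_derivative_on_def)
  then show ?thesis
    by (rule linear_norm_le_basis) (use f xy in \<open>auto simp: hoelder_derivative_on_def\<close>)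
qed

lemma hoelder_derivative_imp_lipschitz:
  fixes f :: "'a::euclidean_space \<Rightarrow> 'b::real_normed_vector"
  assumes f: "hoelder_derivative_on M \<delta> f S" and S: "convex S" "\<And>x y. x \<in> S \<Longrightarrow> y \<in> S \<Longrightarrow> dist x y \<le> 1"
    and M: "0 \<le> M" and \<delta>: "0 < \<delta>"
  shows "\<exists>N\<ge>0. \<forall>x\<in>S. \<forall>y\<in>S. norm (f x - f y) \<le> N * norm (x - y)"
proof (cases "S = {}")
  case False
  then obtain z where z: "z \<in> S" by blast
  define N where "N = real DIM('a) * M + onorm (frechet_derivative f (at z))"
  have diff: "f differentiable (at x)" if "x \<in> S" for x
    using f that by (simp add: hoelder_derivative_on_def)
  have bl: "bounded_linear (frechet_derivative f (at x))" if "x \<in> S" for x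
    using diff[OF that] by (simp add: frechet_derivative_works has_derivative_bounded_linear)
  have "norm (f x - f y) \<le> N * norm (x - y)" if xy: "x \<in> S" "y \<in> S" for x y
  proof (rule differentiable_bound[OF S(1) _ _ xy])
    show "(f has_derivative frechet_derivative f (at x)) (at x within S)" if "x \<in> S" for x
      using diff[OF that] by (simp add: frechet_derivative_works has_derivative_at_withinI)
    show "onorm (frechet_derivative f (at x)) \<le> N" if x: "x \<in> S" for x
    proof (rule onorm_le)
      fix v :: 'a
      have "dist x z powr \<delta> \<le> 1" using S(2)[OF x z] \<delta> by (intro powr_le1) auto
      from mult_left_mono[OF this M] have "M * dist x z powr \<delta> \<le> M" by simp
      then have "real DIM('a) * (M * dist x z powr \<delta>) * norm v \<le> real DIM('a) * M * norm v"
        by (intro mult_right_mono mult_left_mono) auto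
      with hoelder_derivative_close[OF f x z, of v]
      have "norm (frechet_derivative f (at x) v - frechet_derivative f (at z) v)
          \<le> real DIM('a) * M * norm v" by (rule order.trans)
      moreover have "norm (frechet_derivative f (at z) v) \<le> onorm (frechet_derivative f (at z)) * norm v"
        by (rule onorm[OF bl[OF z]])
      ultimately show "norm (frechet_derivative f (at x) v) \<le> N * norm v"
        using norm_triangle_sub[of "frechet_derivative f (at x) v" "frechet_derivative f (at z) v"]
        by (simp add: N_def algebra_simps)
    qed
  qed
  moreover have "0 \<le> N" using M onorm_pos_le[OF bl[OF z]] by (simp add: N_def)
  ultimately show ?thesis by blast
qed auto

text \<open>On a ball of diameter at most \<open>1\<close> the Hoelder exponent may be lowered, and the derivative of \<open>\<phi>\<close>, which is
  Lipschitz, is Hoelder of any exponent up to \<open>1\<close>. So one exponent serves both the submanifold and the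
  weight.\<close>

lemma chart_hoelder_derivatives:
  fixes \<phi> :: "real ^ 'd \<Rightarrow> 'a::euclidean_space"
  assumes lp: "local_param r K U \<phi>" and r: "2 \<le> r" and Q: "C1_Hoelder_on TYPE('d) r \<delta> K Q"
    and sub: "cball u R \<subseteq> U" and R: "R \<le> 1 / 2" and \<delta>': "0 < \<delta>'" "\<delta>' \<le> \<delta>" "\<delta>' \<le> 1"
  obtains M where "0 \<le> M" "hoelder_derivative_on M \<delta>' \<phi> (cball u R)"
    "hoelder_derivative_on M \<delta>' (Q \<circ> \<phi>) (cball u R)"
proof -
  let ?S = "cball u R"
  have dist1: "dist x y \<le> 1" if "x \<in> ?S" "y \<in> ?S" for x y
    using dist_triangle3[of x y u] that R by simp
  have Ck2: "Ck_on 2 \<phi> U" using lp r Ck_on_le by (auto simp: local_param_def)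
  have "\<exists>M\<ge>0. \<forall>x\<in>?S. \<forall>y\<in>?S.
      norm (frechet_derivative \<phi> (at x) b - frechet_derivative \<phi> (at y) b) \<le> M * norm (x - y)" for b
  proof (rule C1_lipschitz_on_compact_convex[OF _ _ _ sub])
    show "Ck_on 1 (\<lambda>x. frechet_derivative \<phi> (at x) b) U"
      using Ck2 by (simp add: numeral_2_eq_2)
  qed auto
  then obtain M where M: "\<And>b. 0 \<le> M b" "\<And>b x y. x \<in> ?S \<Longrightarrow> y \<in> ?S \<Longrightarrow>
      norm (frechet_derivative \<phi> (at x) b - frechet_derivative \<phi> (at y) b) \<le> M b * norm (x - y)"
    by metis
  have "\<exists>M. \<forall>x\<in>?S. \<forall>y\<in>?S.
      \<bar>frechet_derivative (Q \<circ> \<phi>) (at x) h - frechet_derivative (Q \<circ> \<phi>) (at y) h\<bar> \<le> M * dist x y powr \<delta>" for h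
    using Q lp sub unfolding C1_Hoelder_on_def by (meson compact_cball)
  then obtain M' where M': "\<And>h x y. x \<in> ?S \<Longrightarrow> y \<in> ?S \<Longrightarrow>
      \<bar>frechet_derivative (Q \<circ> \<phi>) (at x) h - frechet_derivative (Q \<circ> \<phi>) (at y) h\<bar> \<le> M' h * dist x y powr \<delta>"
    by metis
  define N where "N = (\<Sum>b\<in>(Basis :: (real ^ 'd) set). M b + \<bar>M' b\<bar>)"
  have N: "M b \<le> N" "M' b \<le> N" if "b \<in> Basis" for b :: "real ^ 'd"
  proof -
    have "M b + \<bar>M' b\<bar> \<le> N"
      unfolding N_def by (rule member_le_sum) (use that M(1) in auto)
    then show "M b \<le> N" "M' b \<le> N" using M(1)[of b] by linarith+
  qed
  have N0: "0 \<le> N" using M(1) by (simp add: N_def sum_nonneg)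
  show thesis
  proof (rule that[OF N0])
    show "hoelder_derivative_on N \<delta>' \<phi> ?S"
      unfolding hoelder_derivative_on_def
    proof (intro conjI ballI)
      fix x assume x: "x \<in> ?S"
      show "\<phi> differentiable (at x)" using Ck2 x sub by (auto simp: numeral_2_eq_2)
      fix b :: "real ^ 'd" and y assume b: "b \<in> Basis" and y: "y \<in> ?S"
      have "M b * norm (x - y) \<le> N * dist x y powr \<delta>'"
      proof (intro mult_mono)
        have "dist x y powr 1 \<le> dist x y powr \<delta>'"
          using dist1[OF x y] \<delta>' by (intro powr_mono') auto
        then show "norm (x - y) \<le> dist x y powr \<delta>'" by (simp add: dist_norm)
      qed (use N b N0 in auto)
      then show "norm (frechet_derivative \<phi> (at x) b - frechet_derivative \<phi> (at y) b) \<le> N * dist x y powr \<delta>'"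
        using M(2)[OF x y, of b] by linarith
    qed
    show "hoelder_derivative_on N \<delta>' (Q \<circ> \<phi>) ?S"
      unfolding hoelder_derivative_on_def
    proof (intro conjI ballI)
      fix x assume x: "x \<in> ?S"
      show "(Q \<circ> \<phi>) differentiable (at x)" using Q lp x sub unfolding C1_Hoelder_on_def by blast
      fix b :: "real ^ 'd" and y assume b: "b \<in> Basis" and y: "y \<in> ?S"
      have "M' b * dist x y powr \<delta> \<le> N * dist x y powr \<delta>'"
        using dist1[OF x y] \<delta>' N(2)[OF b] N0 by (intro mult_mono powr_mono') auto
      then show "norm (frechet_derivative (Q \<circ> \<phi>) (at x) b - frechet_derivative (Q \<circ> \<phi>) (at y) b)
          \<le> N * dist x y powr \<delta>'"
        using M'[OF x y, of b] by simp
    qed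
  qed
qed

lemma continuous_on_C1_Hoelder:
  fixes K :: "'a::euclidean_space set"
  assumes K: "submanifold TYPE('d::finite) r K" and Q: "C1_Hoelder_on TYPE('d) r \<delta> K Q"
  shows "continuous_on K Q"
  unfolding continuous_on_eq_continuous_within
proof
  fix p assume "p \<in> K"
  then obtain U and \<phi> :: "real ^ 'd \<Rightarrow> 'a" where lp: "local_param r K U \<phi>" and p: "p \<in> \<phi> ` U"
    using K unfolding submanifold_def by blast
  obtain \<psi> where hom: "homeomorphism U (\<phi> ` U) \<phi> \<psi>" and op: "openin (top_of_set K) (\<phi> ` U)"
    using lp by (auto simp: local_param_def)
  have "continuous_on U (Q \<circ> \<phi>)"
  proof (rule continuous_at_imp_continuous_on, rule ballI)
    fix u assume "u \<in> U"
    then have "(Q \<circ> \<phi>) differentiable (at u)" using Q lp unfolding C1_Hoelder_on_def by blast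
    then show "isCont (Q \<circ> \<phi>) u" by (rule differentiable_imp_continuous_within)
  qed
  then have "continuous_on (\<phi> ` U) ((Q \<circ> \<phi>) \<circ> \<psi>)"
    using continuous_on_compose[OF homeomorphism_cont2[OF hom]] homeomorphism_image2[OF hom] by metis
  then have "continuous_on (\<phi> ` U) Q"
    by (rule continuous_on_eq) (simp add: homeomorphism_apply2[OF hom])
  then have "continuous (at p within \<phi> ` U) Q"
    unfolding continuous_on_eq_continuous_within using p by (rule bspec)
  moreover obtain T where T: "open T" "\<phi> ` U = K \<inter> T" using op unfolding openin_open by blast
  moreover have "at p within K = at p within \<phi> ` U"
  proof (rule at_within_nhd)
    show "p \<in> T" using T(2) p by blast
    show "K \<inter> T - {p} = \<phi> ` U \<inter> T - {p}" unfolding T(2) by blast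
  qed (rule T(1))
  ultimately show "continuous (at p within K) Q" by simp
qed

section \<open>The volume form and the totally real condition\<close>

text \<open>By linearity in each slot, a family on which \<open>f\<close> is nonzero can be replaced, one vector at a time, by
  members of \<open>e\<close>. The resulting choice \<open>e \<circ> \<sigma>\<close> has no repetitions, so \<open>\<sigma>\<close> is a permutation, and a permutation
  of the slots changes the value at most by a sign.\<close>

lemma alternating_form_nonzero_on_basis:
  fixes f :: "('d::finite \<Rightarrow> 'a::real_vector) \<Rightarrow> real"
  assumes alt: "alternating_form_on (span (range e)) f"
    and v: "range v \<subseteq> span (range e)" "f v \<noteq> 0"
  shows "f e \<noteq> 0"
proof -
  let ?T = "span (range e)"
  have lin: "f (v(i := a *\<^sub>R x + b *\<^sub>R y)) = a * f (v(i := x)) + b * f (v(i := y))"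
    if "range v \<subseteq> ?T" "x \<in> ?T" "y \<in> ?T" for v i x y a b
    using alt that unfolding alternating_form_on_def by blast
  have eq0: "f v = 0" if "range v \<subseteq> ?T" "i \<noteq> j" "v i = v j" for v i j
    using alt that unfolding alternating_form_on_def by blast
  have replace: "\<exists>j. f (v(i := e j)) \<noteq> 0" if v: "range v \<subseteq> ?T" "f v \<noteq> 0" for v i
  proof (rule ccontr)
    assume "\<not> ?thesis"
    then have e0: "\<And>j. f (v(i := e j)) = 0" by blast
    have "x \<in> ?T \<and> f (v(i := x)) = 0" if "x \<in> ?T" for x
      using that
    proof (induction rule: span_induct_alt)
      case base
      show ?case
        using lin[OF v(1), of "v i" "v i" i 0 0] v(1) by (simp add: range_subsetD span_zero fun_upd_def)
    next
      case (step c x y)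
      then have "x \<in> ?T" "y \<in> ?T" by (auto intro: span_base)
      then show ?case using lin[OF v(1), of x y i c 1] step e0
        by (auto simp: fun_upd_def intro: span_add span_scale)
    qed
    from this[of "v i"] v show False by (simp add: range_subsetD)
  qed
  have "\<exists>w. range w \<subseteq> ?T \<and> f w \<noteq> 0 \<and> (\<forall>i\<in>S. w i \<in> range e)" if "finite S" for S
    using that
  proof (induction S rule: finite_induct)
    case empty
    then show ?case using v by blast
  next
    case (insert i S)
    then obtain w where w: "range w \<subseteq> ?T" "f w \<noteq> 0" "\<forall>i\<in>S. w i \<in> range e" by blast
    then obtain j where "f (w(i := e j)) \<noteq> 0" using replace by blast
    moreover have "range (w(i := e j)) \<subseteq> ?T" using w(1) by (auto intro: span_base)
    moreover have "\<forall>i'\<in>insert i S. (w(i := e j)) i' \<in> range e" using w(3) by simp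
    ultimately show ?case by blast
  qed
  from this[of UNIV] obtain w where w: "f w \<noteq> 0" "\<forall>i. w i \<in> range e" by auto
  then obtain \<sigma> where \<sigma>: "w = e \<circ> \<sigma>" unfolding image_iff by (metis comp_apply ext UNIV_I)
  have in_T: "range (e \<circ> p) \<subseteq> ?T" for p :: "'d \<Rightarrow> 'd" by (auto intro: span_base)
  have "inj \<sigma>"
  proof (rule injI, rule ccontr)
    fix i j assume "\<sigma> i = \<sigma> j" "i \<noteq> j"
    then have "f (e \<circ> \<sigma>) = 0" by (intro eq0[OF in_T, of i j]) auto
    then show False using w(1) \<sigma> by simp
  qed
  then have perm: "\<sigma> permutes UNIV"
    by (intro bij_imp_permutes) (auto simp: bij_def finite_UNIV_inj_surj)
  have swap_sign: "f (v \<circ> Transposition.transpose i j) = - f v" if v: "range v \<subseteq> ?T" and ij: "i \<noteq> j" for v i j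
  proof -
    define g where "g x y = f (v(i := x, j := y))" for x y
    have vT: "v i \<in> ?T" "v j \<in> ?T" using v by auto
    have add1: "g (x + x') y = g x y + g x' y" if "x \<in> ?T" "x' \<in> ?T" "y \<in> ?T" for x x' y
    proof -
      have "f ((v(j := y))(i := 1 *\<^sub>R x + 1 *\<^sub>R x')) = 1 * f ((v(j := y))(i := x)) + 1 * f ((v(j := y))(i := x'))"
        using v that by (intro lin) auto
      then show ?thesis unfolding g_def using ij by (simp add: fun_upd_twist)
    qed
    have add2: "g x (y + y') = g x y + g x y'" if "x \<in> ?T" "y \<in> ?T" "y' \<in> ?T" for x y y'
    proof -
      have "f ((v(i := x))(j := 1 *\<^sub>R y + 1 *\<^sub>R y')) = 1 * f ((v(i := x))(j := y)) + 1 * f ((v(i := x))(j := y'))"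
        using v that by (intro lin) auto
      then show ?thesis unfolding g_def by simp
    qed
    have diag: "g x x = 0" if "x \<in> ?T" for x
      unfolding g_def using v that ij by (intro eq0[of _ i j]) auto
    have sum_T: "v i + v j \<in> ?T" using vT by (rule span_add)
    have "0 = g (v i + v j) (v i + v j)" using diag[OF sum_T] by simp
    also have "\<dots> = g (v i) (v j) + g (v j) (v i)"
      by (simp add: add1[OF vT sum_T] add2 vT diag[OF vT(1)] diag[OF vT(2)])
    finally have "g (v j) (v i) = - g (v i) (v j)" by simp
    moreover have "v \<circ> Transposition.transpose i j = v(i := v j, j := v i)"
      using ij by (auto simp: fun_eq_iff Transposition.transpose_def)
    moreover have "v(i := v i, j := v j) = v" by simp
    ultimately show ?thesis by (simp add: g_def)
  qed
  have "f (e \<circ> \<sigma>) \<noteq> 0 \<longrightarrow> f e \<noteq> 0"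
    using finite perm
  proof (induction \<sigma> rule: permutes_rev_induct)
    case id
    then show ?case by simp
  next
    case (swap a b p)
    have "f (e \<circ> p \<circ> Transposition.transpose a b) = - f (e \<circ> p)"
      using swap(3) by (rule swap_sign[OF in_T])
    with swap show ?case unfolding o_assoc by (metis neg_equal_0_iff_equal)
  qed
  then show ?thesis using w(1) \<sigma> by simp
qed

text \<open>The map \<open>(a, b) \<mapsto> L a + \<i> L b\<close> goes between real spaces of the same dimension, so surjectivity is the
  same as injectivity, and injectivity in the form of a lower bound survives small perturbations of
  \<open>L\<close>. This turns the totally real condition at one point into a uniform one nearby.\<close>

lemma complex_decomposition_stable:
  fixes L0 :: "real ^ 'n \<Rightarrow> complex ^ 'n"
  assumes L0: "linear L0" and surj: "\<And>w. \<exists>a b. w = L0 a + \<i> *s L0 b"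
  obtains c where "0 < c"
    "\<And>L w. linear L \<Longrightarrow> (\<And>v. norm (L v - L0 v) \<le> c * norm v) \<Longrightarrow>
      \<exists>a b. w = L a + \<i> *s L b \<and> norm a \<le> norm w / c \<and> norm b \<le> norm w / c"
proof -
  define T where "T L x = L (fst x) + \<i> *s L (snd x)"
    for L :: "real ^ 'n \<Rightarrow> complex ^ 'n" and x :: "(real ^ 'n) \<times> (real ^ 'n)"
  have T: "linear (T L)" if "linear L" for L
  proof (rule linearI)
    show "T L (x + y) = T L x + T L y" for x y
      by (simp add: T_def linear_add[OF that] vector_add_ldistrib)
    show "T L (c *\<^sub>R x) = c *\<^sub>R T L x" for c x
      by (simp add: T_def linear_scale[OF that] scaleR_add_right vec_eq_iff)
  qed
  have dims: "DIM(complex ^ 'n) = DIM((real ^ 'n) \<times> (real ^ 'n))" by simp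
  have "surj (T L0)" unfolding T_def using surj by (auto simp: surj_def)
  then have "inj (T L0)"
    using T[OF L0] dims by (intro eucl.linear_surjective_imp_injective) auto
  then obtain B where B: "B > 0" "\<And>x. B * norm x \<le> norm (T L0 x)"
    using linear_inj_bounded_below_pos[OF T[OF L0]] by blast
  show thesis
  proof
    show "0 < B / 4" using B by simp
    fix L :: "real ^ 'n \<Rightarrow> complex ^ 'n" and w
    assume L: "linear L" and close: "\<And>v. norm (L v - L0 v) \<le> B / 4 * norm v"
    have lower: "B / 2 * norm x \<le> norm (T L x)" for x
    proof -
      have "norm (T L0 x - T L x) = norm ((L0 (fst x) - L (fst x)) + \<i> *s (L0 (snd x) - L (snd x)))"
        by (simp add: T_def algebra_simps vector_ssub_ldistrib)
      also have "\<dots> \<le> norm (L (fst x) - L0 (fst x)) + norm (L (snd x) - L0 (snd x))"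
        by (rule order.trans[OF norm_triangle_ineq])
          (simp add: norm_vector_smult norm_minus_commute del: vector_ssub_ldistrib)
      also have "\<dots> \<le> B / 4 * norm x + B / 4 * norm x"
        using B(1) by (intro add_mono order.trans[OF close] mult_left_mono)
          (use norm_fst_le[of "fst x" "snd x"] norm_snd_le[of "snd x" "fst x"] in auto)
      finally have "norm (T L0 x) \<le> norm (T L x) + B / 2 * norm x"
        using norm_triangle_sub[of "T L0 x" "T L x"] by simp
      then show ?thesis using B(2)[of x] by linarith
    qed
    have "inj (T L)"
      unfolding linear_injective_0[OF T[OF L]]
    proof (intro allI impI)
      fix x assume "T L x = 0"
      then have "B / 2 * norm x \<le> 0" using lower[of x] by simp
      then have "norm x \<le> 0" using B(1) by (simp add: mult_le_0_iff)
      then show "x = 0" by simp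
    qed
    then have "surj (T L)"
      using T[OF L] dims by (intro eucl.linear_injective_imp_surjective) auto
    then obtain x where x: "w = T L x" by blast
    have "norm x \<le> norm w / (B / 4)"
    proof -
      have "B * norm x \<le> 2 * norm (T L x)" using lower[of x] by simp
      then have "B * norm x \<le> 4 * norm (T L x)" using norm_ge_zero[of "T L x"] by linarith
      then show ?thesis using B(1) by (simp add: x pos_le_divide_eq mult.commute)
    qed
    then show "\<exists>a b. w = L a + \<i> *s L b \<and> norm a \<le> norm w / (B / 4) \<and> norm b \<le> norm w / (B / 4)"
      using norm_fst_le[of "fst x" "snd x"] norm_snd_le[of "snd x" "fst x"]
      by (intro exI[of _ "fst x"] exI[of _ "snd x"]) (auto simp: x T_def)
  qed
qed

lemma form_coeff_nonzero:
  fixes \<phi> :: "real ^ 'd \<Rightarrow> 'a::euclidean_space"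
  assumes lp: "local_param r K U \<phi>" and r: "1 \<le> r" and u: "u \<in> U"
    and \<omega>: "smooth_volume_form r K \<omega>"
  shows "form_coeff \<omega> \<phi> u \<noteq> 0"
proof -
  let ?L = "frechet_derivative \<phi> (at u)"
  let ?e = "\<lambda>i. ?L (axis i 1)"
  have "\<phi> differentiable (at u)"
    using lp u Ck_on_le[of r \<phi> U 1] r by (auto simp: local_param_def)
  then have L: "linear ?L" by (rule linear_frechet_derivative)
  have axes: "span (range (\<lambda>i. axis i 1 :: real ^ 'd)) = UNIV"
  proof -
    have "Basis = range (\<lambda>i. axis i 1 :: real ^ 'd)" by (auto simp: Basis_vec_def)
    then show ?thesis using span_Basis by metis
  qed
  have T: "tangent_space K (\<phi> u) = span (range ?e)"
  proof -
    have "range ?L = ?L ` span (range (\<lambda>i. axis i 1))" by (simp only: axes)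
    also have "\<dots> = span (?L ` range (\<lambda>i. axis i 1))" by (rule linear_span_image[OF L, symmetric])
    finally show ?thesis by (simp add: tangent_space_local_param[OF lp r u] image_image)
  qed
  have "\<phi> u \<in> K" using lp u openin_imp_subset unfolding local_param_def by blast
  then obtain v where v: "range v \<subseteq> span (range ?e)" "\<omega> (\<phi> u) v \<noteq> 0"
      and alt: "alternating_form_on (span (range ?e)) (\<omega> (\<phi> u))"
    using \<omega> unfolding smooth_volume_form_def T[symmetric] by blast
  show ?thesis
    unfolding form_coeff_def by (rule alternating_form_nonzero_on_basis[OF alt v])
qed

lemma form_measure_chart_ball:
  fixes \<phi> :: "real ^ 'd \<Rightarrow> 'a::euclidean_space"
  assumes K: "compact K" and lp: "local_param r K U \<phi>" and \<mu>: "is_form_measure r K \<omega> \<mu>"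
    and sub: "ball u R \<subseteq> U" and R: "0 \<le> R" and c: "0 \<le> c" "\<And>v. v \<in> ball u R \<Longrightarrow> c \<le> \<bar>form_coeff \<omega> \<phi> v\<bar>"
  shows "\<phi> ` ball u R \<in> sets borel"
    and "ennreal (c * unit_ball_vol (real CARD('d)) * R ^ CARD('d)) \<le> emeasure \<mu> (\<phi> ` ball u R)"
proof -
  obtain \<psi> where hom: "homeomorphism U (\<phi> ` U) \<phi> \<psi>" and op: "openin (top_of_set K) (\<phi> ` U)"
    using lp by (auto simp: local_param_def)
  have "openin (top_of_set U) (ball u R)" using sub by (simp add: open_subset)
  then have "openin (top_of_set K) (\<phi> ` ball u R)"
    using homeomorphism_imp_open_map[OF hom] op openin_trans by blast
  then obtain T where "open T" "\<phi> ` ball u R = K \<inter> T" unfolding openin_open by blast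
  then show meas: "\<phi> ` ball u R \<in> sets borel" using K by (simp add: sets.Int borel_compact borel_open)
  have inj: "inj_on \<phi> U" using homeomorphism_apply1[OF hom] by (rule inj_on_inverseI)
  have "U \<inter> \<phi> -` \<phi> ` ball u R = ball u R"
  proof (intro equalityI subsetI)
    fix v assume "v \<in> U \<inter> \<phi> -` \<phi> ` ball u R"
    then have "v \<in> U" "\<phi> v \<in> \<phi> ` ball u R" by blast+
    then show "v \<in> ball u R" using inj_on_image_mem_iff[OF inj _ sub] by blast
  next
    fix v assume "v \<in> ball u R"
    then show "v \<in> U \<inter> \<phi> -` \<phi> ` ball u R" using sub by blast
  qed
  moreover have "emeasure \<mu> (\<phi> ` ball u R) =
      (\<integral>\<^sup>+v\<in>U \<inter> \<phi> -` \<phi> ` ball u R. ennreal \<bar>form_coeff \<omega> \<phi> v\<bar> \<partial>lborel)"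
  proof -
    have "\<phi> ` ball u R \<subseteq> \<phi> ` U" using sub by (rule image_mono)
    then show ?thesis using \<mu> lp meas unfolding is_form_measure_def by blast
  qed
  ultimately have "emeasure \<mu> (\<phi> ` ball u R) = (\<integral>\<^sup>+v\<in>ball u R. ennreal \<bar>form_coeff \<omega> \<phi> v\<bar> \<partial>lborel)"
    by simp
  moreover have "(\<integral>\<^sup>+v\<in>ball u R. ennreal c \<partial>lborel) \<le> \<dots>"
    by (intro nn_integral_mono) (auto simp: indicator_def c intro!: ennreal_leI)
  moreover have "(\<integral>\<^sup>+v\<in>ball u R. ennreal c \<partial>lborel)
      = ennreal (c * unit_ball_vol (real CARD('d)) * R ^ CARD('d))"
    using c(1) R by (simp add: nn_integral_cmult_indicator emeasure_ball ennreal_mult' mult.assoc)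
  ultimately show "ennreal (c * unit_ball_vol (real CARD('d)) * R ^ CARD('d)) \<le> emeasure \<mu> (\<phi> ` ball u R)"
    by simp
qed

section \<open>Uniform local geometry\<close>

text \<open>Each small ball around \<open>p\<close> contains a part of \<open>K\<close> with at least the measure expected in real dimension
  \<open>n\<close>, on which \<open>Q\<close> varies by no more than a multiple of the radius. Asking this of some part of the ball
  rather than of all of it lets the part be the image of a ball in a chart.\<close>

definition thick ::
  "(complex ^ 'n) set \<Rightarrow> (complex ^ 'n) measure \<Rightarrow> (complex ^ 'n \<Rightarrow> real) \<Rightarrow> real \<Rightarrow> real
     \<Rightarrow> complex ^ 'n \<Rightarrow> bool" where
  "thick K \<mu> Q C \<rho> p \<longleftrightarrow>
     (\<forall>R. 0 < R \<longrightarrow> R \<le> \<rho> \<longrightarrow>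
        (\<exists>S\<in>sets borel. S \<subseteq> K \<inter> cball p R \<and> (\<forall>q\<in>S. \<bar>Q q - Q p\<bar> \<le> C * R) \<and>
           ennreal (R ^ CARD('n) / C) \<le> emeasure \<mu> S))"

lemma osculated_mono:
  fixes K :: "(complex ^ 'n) set"
  assumes "osculated K Q \<delta> C \<rho> p" "C \<le> C'" "\<rho>' \<le> \<rho>"
  shows "osculated K Q \<delta> C' \<rho>' p"
proof -
  obtain L :: "real ^ 'n \<Rightarrow> complex ^ 'n" and l :: "real ^ 'n \<Rightarrow> real"
    where L: "linear L" and l: "linear l"
      and dec: "\<And>w. \<exists>a b. w = L a + \<i> *s L b \<and> norm a \<le> C * norm w \<and> norm b \<le> C * norm w"
      and near: "\<And>v. norm v \<le> \<rho> \<Longrightarrow> \<exists>q\<in>K. norm (q - (p + L v)) \<le> C * norm v powr (1 + \<delta>) \<and>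
                                \<bar>Q q - (Q p + l v)\<bar> \<le> C * norm v powr (1 + \<delta>)"
    using assms(1) unfolding osculated_def by blast
  have "C * norm w \<le> C' * norm w" for w :: "complex ^ 'n"
    using assms(2) by (intro mult_right_mono) auto
  moreover have "C * norm v powr (1 + \<delta>) \<le> C' * norm v powr (1 + \<delta>)" for v :: "real ^ 'n"
    using assms(2) by (intro mult_right_mono) auto
  ultimately show ?thesis
    unfolding osculated_def using L l dec near assms(3)
    by (intro exI[of _ L] exI[of _ l]) (meson order.trans)
qed

lemma thick_mono:
  fixes K :: "(complex ^ 'n) set"
  assumes t: "thick K \<mu> Q C \<rho> p" and C: "0 < C" "C \<le> C'" and \<rho>: "\<rho>' \<le> \<rho>"
  shows "thick K \<mu> Q C' \<rho>' p"
  unfolding thick_def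
proof (intro allI impI)
  fix R assume R: "0 < R" "R \<le> \<rho>'"
  then obtain S where S: "S \<in> sets borel" "S \<subseteq> K \<inter> cball p R" "\<forall>q\<in>S. \<bar>Q q - Q p\<bar> \<le> C * R"
      "ennreal (R ^ CARD('n) / C) \<le> emeasure \<mu> S"
    using t \<rho> unfolding thick_def by (meson order.trans)
  have "C * R \<le> C' * R" using C R by (intro mult_right_mono) auto
  moreover have "R ^ CARD('n) / C' \<le> R ^ CARD('n) / C" using C R by (intro divide_left_mono) auto
  then have "ennreal (R ^ CARD('n) / C') \<le> ennreal (R ^ CARD('n) / C)" by (rule ennreal_leI)
  ultimately show "\<exists>S\<in>sets borel. S \<subseteq> K \<inter> cball p R \<and> (\<forall>q\<in>S. \<bar>Q q - Q p\<bar> \<le> C' * R) \<and>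
           ennreal (R ^ CARD('n) / C') \<le> emeasure \<mu> S"
    using S by (intro bexI[of _ S]) (auto intro: order.trans)
qed

text \<open>The constant and the reciprocal of the radius are bounded by the same number \<open>t\<close>, so that the two
  properties become weaker as \<open>t\<close> grows and a compactness argument can choose \<open>t\<close> uniformly.\<close>

lemma local_geometry:
  fixes K :: "(complex ^ 'n) set" and \<omega> :: "complex ^ 'n \<Rightarrow> ('n \<Rightarrow> complex ^ 'n) \<Rightarrow> real"
  assumes K: "compact K" "maximally_totally_real 5 K"
    and \<omega>: "smooth_volume_form 5 K \<omega>" and \<mu>: "is_form_measure 5 K \<omega> \<mu>"
    and Q: "C1_Hoelder_on TYPE('n) 5 \<delta> K Q"
    and \<delta>': "0 < \<delta>'" "\<delta>' \<le> \<delta>" "\<delta>' \<le> 1" and p0: "p0 \<in> K"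
  shows "\<exists>N t. open N \<and> p0 \<in> N \<and> 1 \<le> t \<and>
    (\<forall>p\<in>K \<inter> N. osculated K Q \<delta>' t (1 / t) p \<and> thick K \<mu> Q t (1 / t) p)"
proof -
  obtain U and \<phi> :: "real ^ 'n \<Rightarrow> complex ^ 'n" where lp: "local_param 5 K U \<phi>" and "p0 \<in> \<phi> ` U"
    using K(2) p0 unfolding maximally_totally_real_def submanifold_def by blast
  then obtain u0 where u0: "u0 \<in> U" "p0 = \<phi> u0" by blast
  obtain \<psi> where U: "open U" and hom: "homeomorphism U (\<phi> ` U) \<phi> \<psi>" and op: "openin (top_of_set K) (\<phi> ` U)"
    using lp by (auto simp: local_param_def)
  have \<phi>K: "\<phi> u \<in> K" if "u \<in> U" for u using openin_imp_subset[OF op] that by blast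
  obtain R0 where R0: "0 < R0" "cball u0 R0 \<subseteq> U" using U u0 open_contains_cball by blast
  define R where "R = min R0 (1 / 2)"
  define S where "S = cball u0 R"
  have R: "0 < R" "R \<le> 1 / 2" using R0 by (auto simp: R_def)
  have SU: "S \<subseteq> U" using R0 by (auto simp: S_def R_def)
  obtain M where M: "0 \<le> M" "hoelder_derivative_on M \<delta>' \<phi> S" "hoelder_derivative_on M \<delta>' (Q \<circ> \<phi>) S"
    using chart_hoelder_derivatives[OF lp _ Q SU[unfolded S_def] R(2) \<delta>'] unfolding S_def by auto
  have S: "convex S" "\<And>x y. x \<in> S \<Longrightarrow> y \<in> S \<Longrightarrow> dist x y \<le> 1"
  proof -
    show "convex S" by (simp add: S_def)
    show "dist x y \<le> 1" if "x \<in> S" "y \<in> S" for x y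
      using dist_triangle3[of x y u0] that R by (simp add: S_def)
  qed
  obtain M1 where M1: "0 \<le> M1" "\<And>x y. x \<in> S \<Longrightarrow> y \<in> S \<Longrightarrow> norm (\<phi> x - \<phi> y) \<le> M1 * norm (x - y)"
    using hoelder_derivative_imp_lipschitz[OF M(2) S M(1) \<delta>'(1)] by blast
  obtain M2 where M2: "0 \<le> M2" "\<And>x y. x \<in> S \<Longrightarrow> y \<in> S \<Longrightarrow> norm ((Q \<circ> \<phi>) x - (Q \<circ> \<phi>) y) \<le> M2 * norm (x - y)"
    using hoelder_derivative_imp_lipschitz[OF M(3) S M(1) \<delta>'(1)] by blast
  define n where "n = real CARD('n)"
  define L where "L u = frechet_derivative \<phi> (at u)" for u
  have L: "linear (L u)" if "u \<in> S" for u
    unfolding L_def using M(2) that by (intro linear_frechet_derivative) (simp add: hoelder_derivative_on_def)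
  have u0S: "u0 \<in> S" using R by (simp add: S_def)
  have "\<exists>a b. w = L u0 a + \<i> *s L u0 b" for w
  proof -
    have "w \<in> {v + \<i> *s w | v w. v \<in> tangent_space K (\<phi> u0) \<and> w \<in> tangent_space K (\<phi> u0)}"
      using K(2) \<phi>K[OF u0(1)] unfolding maximally_totally_real_def by auto
    then show ?thesis
      unfolding tangent_space_local_param[OF lp _ u0(1), simplified] L_def by blast
  qed
  then obtain c where c: "0 < c" "\<And>A w. linear A \<Longrightarrow> (\<And>v. norm (A v - L u0 v) \<le> c * norm v) \<Longrightarrow>
      \<exists>a b. w = A a + \<i> *s A b \<and> norm a \<le> norm w / c \<and> norm b \<le> norm w / c"
    using complex_decomposition_stable[OF L[OF u0S]] by blast
  obtain R1 where R1: "0 < R1" "R1 powr \<delta>' \<le> c / (n * M + 1)"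
    using exists_small_scale[of \<delta>' "c / (n * M + 1)"] \<delta>' c(1) M(1)
    by (auto simp: n_def add_nonneg_pos)
  define g where "g = form_coeff \<omega> \<phi>"
  have g0: "0 < \<bar>g u0\<bar>" using form_coeff_nonzero[OF lp _ u0(1) \<omega>] by (simp add: g_def)
  have "continuous_on U g"
    using \<omega> lp Ck_on_le[of "5 - 1" g U 0] unfolding smooth_volume_form_def g_def by auto
  then have "isCont g u0" using U u0(1) by (simp add: continuous_on_eq_continuous_at)
  then obtain R2 where R2: "0 < R2" "\<And>u. dist u u0 < R2 \<Longrightarrow> dist (g u) (g u0) < \<bar>g u0\<bar> / 2"
    using g0 unfolding continuous_at_eps_delta by (meson half_gt_zero)
  define \<rho> where "\<rho> = Min {R, R1, R2} / 3"
  have \<rho>: "0 < \<rho>" "2 * \<rho> \<le> R" "\<rho> \<le> R1" "2 * \<rho> < R2"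
    using R(1) R1(1) R2(1) by (auto simp: \<rho>_def min_def)
  have near_S: "v \<in> S" if "dist u0 u < \<rho>" "dist u v \<le> \<rho>" for u v
    using dist_triangle[of u0 v u] that \<rho> by (simp add: S_def)
  have "openin (top_of_set U) (ball u0 \<rho>)"
    using SU \<rho> by (intro open_subset) (auto simp: S_def)
  then have "openin (top_of_set K) (\<phi> ` ball u0 \<rho>)"
    using homeomorphism_imp_open_map[OF hom] op openin_trans by blast
  then obtain N where N: "open N" "\<phi> ` ball u0 \<rho> = K \<inter> N" unfolding openin_open by blast
  define m where "m = M1 + 1"
  define \<nu> where "\<nu> = \<bar>g u0\<bar> / 2 * unit_ball_vol (real CARD('n))"
  have m: "1 \<le> m" "0 < m" using M1(1) by (auto simp: m_def)
  have \<nu>: "0 < \<nu>" using g0 by (simp add: \<nu>_def)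
  \<comment> \<open>A single constant that dominates everything needed: the reciprocal radius, the decomposition
    constant, the Taylor constant, the Lipschitz constant of \<open>Q \<circ> \<phi>\<close> and the reciprocal density.\<close>
  define t where "t = 1 + 1 / \<rho> + 1 / c + n * M + M2 + m ^ CARD('n) / \<nu>"
  have summands: "0 \<le> 1 / \<rho>" "0 \<le> 1 / c" "0 \<le> n * M" "0 \<le> M2" "0 \<le> m ^ CARD('n) / \<nu>"
    using \<rho> c M(1) M2(1) m \<nu> by (auto simp: n_def)
  have t: "1 \<le> t" "1 / \<rho> \<le> t" "1 / c \<le> t" "n * M \<le> t" "M2 \<le> t" "m ^ CARD('n) / \<nu> \<le> t"
    unfolding t_def using summands by linarith+
  have t\<rho>: "1 / t \<le> \<rho>" using t(1,2) \<rho>(1) by (simp add: field_simps)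
  have osc: "osculated K Q \<delta>' t (1 / t) (\<phi> u)" if u: "dist u0 u < \<rho>" for u
  proof -
    have uS: "u \<in> S" using near_S[OF u, of u] \<rho> by simp
    have close: "norm (L u v - L u0 v) \<le> c * norm v" for v
    proof -
      have "M * dist u u0 powr \<delta>' \<le> M * R1 powr \<delta>'"
        using u \<rho> \<delta>' M(1) by (intro mult_left_mono powr_mono2) (auto simp: dist_commute)
      also have "\<dots> \<le> M * (c / (n * M + 1))" using R1 M(1) by (intro mult_left_mono) auto
      finally have "M * dist u u0 powr \<delta>' \<le> M * (c / (n * M + 1))" .
      then have "n * (M * dist u u0 powr \<delta>') \<le> n * (M * (c / (n * M + 1)))"
        by (rule mult_left_mono) (simp add: n_def)
      also have "\<dots> \<le> c"
        using c(1) summands(3) by (simp add: field_simps)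
      finally have "n * (M * dist u u0 powr \<delta>') * norm v \<le> c * norm v" by (rule mult_right_mono) simp
      with hoelder_derivative_close[OF M(2) uS u0S, of v] show ?thesis by (simp add: L_def n_def)
    qed
    have decomp: "\<exists>a b. w = L u a + \<i> *s L u b \<and> norm a \<le> t * norm w \<and> norm b \<le> t * norm w" for w
    proof -
      have "norm w / c \<le> t * norm w" using mult_right_mono[OF t(3), of "norm w"] by simp
      moreover obtain a b where "w = L u a + \<i> *s L u b" "norm a \<le> norm w / c" "norm b \<le> norm w / c"
        using c(2)[OF L[OF uS] close] by blast
      ultimately show ?thesis by (intro exI[of _ a] exI[of _ b]) linarith
    qed
    have taylor: "norm (f (u + h) - f u - frechet_derivative f (at u) h) \<le> t * norm h powr (1 + \<delta>')"
      if f: "hoelder_derivative_on M \<delta>' f S" and h: "norm h \<le> \<rho>"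
      for f :: "real ^ 'n \<Rightarrow> 'b::real_normed_vector" and h
    proof -
      have "u + h \<in> S" using near_S[OF u, of "u + h"] h by (simp add: dist_norm)
      then have "norm (f (u + h) - f u - frechet_derivative f (at u) (u + h - u))
          \<le> real DIM(real ^ 'n) * M * norm (u + h - u) powr (1 + \<delta>')"
        using f by (intro hoelder_taylor[OF S(1) _ _ M(1) \<delta>'(1) uS]) (auto simp: hoelder_derivative_on_def)
      also have "\<dots> \<le> t * norm h powr (1 + \<delta>')"
        using t(4) by (auto simp: n_def intro!: mult_right_mono)
      finally show ?thesis by simp
    qed
    show ?thesis
      unfolding osculated_def
    proof (intro exI[of _ "L u"] exI[of _ "frechet_derivative (Q \<circ> \<phi>) (at u)"] conjI allI impI)
      show "linear (L u)" by (rule L[OF uS])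
      show "linear (frechet_derivative (Q \<circ> \<phi>) (at u))"
        using M(3) uS by (intro linear_frechet_derivative) (simp add: hoelder_derivative_on_def)
      show "\<exists>a b. w = L u a + \<i> *s L u b \<and> norm a \<le> t * norm w \<and> norm b \<le> t * norm w" for w
        by (rule decomp)
      fix h :: "real ^ 'n" assume "norm h \<le> 1 / t"
      then have h: "norm h \<le> \<rho>" using t\<rho> by linarith
      have "u + h \<in> U" using near_S[OF u, of "u + h"] h SU by (auto simp: dist_norm)
      then show "\<exists>q\<in>K. norm (q - (\<phi> u + L u h)) \<le> t * norm h powr (1 + \<delta>') \<and>
          \<bar>Q q - (Q (\<phi> u) + frechet_derivative (Q \<circ> \<phi>) (at u) h)\<bar> \<le> t * norm h powr (1 + \<delta>')"
        using taylor[OF M(2) h] taylor[OF M(3) h] \<phi>K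
        by (intro bexI[of _ "\<phi> (u + h)"]) (auto simp: L_def diff_diff_eq)
    qed
  qed
  have thk: "thick K \<mu> Q t (1 / t) (\<phi> u)" if u: "dist u0 u < \<rho>" for u
    unfolding thick_def
  proof (intro allI impI)
    fix r assume r: "0 < r" "r \<le> 1 / t"
    define B where "B = ball u (r / m)"
    have rm: "r / m \<le> r" "0 < r / m" using m r divide_left_mono[of 1 m r] by auto
    have uS: "u \<in> S" using near_S[OF u, of u] \<rho> by simp
    have B: "dist u v < r / m \<and> dist u v \<le> \<rho> \<and> v \<in> S" if "v \<in> B" for v
      using that near_S[OF u, of v] rm r t\<rho> by (auto simp: B_def)
    have BU: "B \<subseteq> U" using B SU by blast
    have g_lower: "\<bar>g u0\<bar> / 2 \<le> \<bar>form_coeff \<omega> \<phi> v\<bar>" if "v \<in> B" for v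
    proof -
      have "dist v u0 < R2" using dist_triangle[of u0 v u] B[OF that] u \<rho> by (simp add: dist_commute)
      from R2(2)[OF this] show ?thesis unfolding g_def dist_real_def by linarith
    qed
    have lip: "norm (\<phi> v - \<phi> u) \<le> r \<and> \<bar>Q (\<phi> v) - Q (\<phi> u)\<bar> \<le> t * r" if v: "v \<in> B" for v
    proof -
      have d: "norm (v - u) \<le> r / m" using B[OF v] by (simp add: dist_norm norm_minus_commute)
      have "norm (\<phi> v - \<phi> u) \<le> m * (r / m)"
        using M1(1) d by (intro order.trans[OF M1(2)] mult_mono) (use B[OF v] uS in \<open>auto simp: m_def\<close>)
      moreover have "norm ((Q \<circ> \<phi>) v - (Q \<circ> \<phi>) u) \<le> t * r"
        using M2(1) d rm t r by (intro order.trans[OF M2(2)] mult_mono) (use B[OF v] uS in auto)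
      ultimately show ?thesis using m by simp
    qed
    show "\<exists>A\<in>sets borel. A \<subseteq> K \<inter> cball (\<phi> u) r \<and> (\<forall>q\<in>A. \<bar>Q q - Q (\<phi> u)\<bar> \<le> t * r) \<and>
           ennreal (r ^ CARD('n) / t) \<le> emeasure \<mu> A"
    proof (intro bexI[of _ "\<phi> ` B"] conjI)
      show "\<phi> ` B \<subseteq> K \<inter> cball (\<phi> u) r"
        using lip BU \<phi>K by (auto simp: dist_norm norm_minus_commute)
      show "\<forall>q\<in>\<phi> ` B. \<bar>Q q - Q (\<phi> u)\<bar> \<le> t * r" using lip by blast
      have "r ^ CARD('n) * (m ^ CARD('n) / \<nu>) \<le> r ^ CARD('n) * t"
        using t(6) r by (intro mult_left_mono) auto
      then have "r ^ CARD('n) / t \<le> \<nu> * (r / m) ^ CARD('n)"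
        using t(1) m \<nu> by (simp add: power_divide field_simps)
      then have "ennreal (r ^ CARD('n) / t) \<le> ennreal (\<nu> * (r / m) ^ CARD('n))" by (rule ennreal_leI)
      also have "\<dots> \<le> emeasure \<mu> (\<phi> ` B)"
        unfolding B_def \<nu>_def
        by (rule form_measure_chart_ball(2)[OF K(1) lp \<mu> BU[unfolded B_def]])
          (use rm g_lower in \<open>auto simp: B_def\<close>)
      finally show "ennreal (r ^ CARD('n) / t) \<le> emeasure \<mu> (\<phi> ` B)" .
      show "\<phi> ` B \<in> sets borel"
        unfolding B_def
        by (rule form_measure_chart_ball(1)[OF K(1) lp \<mu> BU[unfolded B_def], of 0]) (use rm in auto)
    qed
  qed
  show ?thesis
  proof (intro exI[of _ N] exI[of _ t] conjI ballI)
    show "open N" "1 \<le> t" by fact+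
    show "p0 \<in> N" using N(2) u0(2) \<rho>(1) by (metis Int_iff centre_in_ball imageI)
    fix p assume "p \<in> K \<inter> N"
    then obtain u where "p = \<phi> u" "dist u0 u < \<rho>" unfolding N(2)[symmetric] by auto
    then show "osculated K Q \<delta>' t (1 / t) p" "thick K \<mu> Q t (1 / t) p" using osc thk by auto
  qed
qed

lemma compact_uniform_constant:
  fixes K :: "'a::topological_space set" and P :: "real \<Rightarrow> 'a \<Rightarrow> bool"
  assumes K: "compact K"
    and local: "\<And>p. p \<in> K \<Longrightarrow> \<exists>N t. open N \<and> p \<in> N \<and> 1 \<le> t \<and> (\<forall>q\<in>K \<inter> N. P t q)"
    and mono: "\<And>s t q. 1 \<le> s \<Longrightarrow> s \<le> t \<Longrightarrow> P s q \<Longrightarrow> P t q"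
  obtains t where "1 \<le> t" "\<And>q. q \<in> K \<Longrightarrow> P t q"
proof -
  obtain N t where N: "\<And>p. p \<in> K \<Longrightarrow> open (N p) \<and> p \<in> N p \<and> 1 \<le> t p \<and> (\<forall>q\<in>K \<inter> N p. P (t p) q)"
    using local by metis
  obtain D where D: "D \<subseteq> K" "finite D" "K \<subseteq> (\<Union>p\<in>D. N p)"
    using compactE_image[OF K, of K N] N by blast
  define s where "s = 1 + (\<Sum>p\<in>D. t p)"
  have t1: "1 \<le> t p" if "p \<in> D" for p using N D that by blast
  have "0 \<le> t p" if "p \<in> D" for p using t1[OF that] by linarith
  then have sum0: "0 \<le> (\<Sum>p\<in>D. t p)" by (rule sum_nonneg)
  have s: "t p \<le> s" if "p \<in> D" for p
  proof -
    have "t p \<le> (\<Sum>p\<in>D. t p)" using that t1 D(2) by (intro member_le_sum) (auto intro: order.trans[of 0 1])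
    then show ?thesis by (simp add: s_def)
  qed
  show thesis
  proof
    show "1 \<le> s" using sum0 by (simp add: s_def)
    fix q assume q: "q \<in> K"
    then obtain p where p: "p \<in> D" "q \<in> N p" using D(3) by blast
    then have "P (t p) q" using N D(1) q by blast
    then show "P s q" using mono[OF t1[OF p(1)] s[OF p(1)]] by blast
  qed
qed

section \<open>From the sup norm to the square norm\<close>

lemma polynomials_upto_scale:
  assumes "s \<in> polynomials_upto k"
  shows "(\<lambda>z. a * s z) \<in> polynomials_upto k"
proof -
  obtain c where s: "s = (\<lambda>z. \<Sum>\<alpha> | (\<Sum>i\<in>UNIV. \<alpha> i) \<le> k. c \<alpha> * (\<Prod>i\<in>UNIV. (z $ i) ^ \<alpha> i))"
    using assms by (auto simp: polynomials_upto_def)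
  have "(\<lambda>z. a * s z) = (\<lambda>z. \<Sum>\<alpha> | (\<Sum>i\<in>UNIV. \<alpha> i) \<le> k. (a * c \<alpha>) * (\<Prod>i\<in>UNIV. (z $ i) ^ \<alpha> i))"
    by (simp add: s sum_distrib_left mult.assoc)
  then show ?thesis
    unfolding polynomials_upto_def by (intro CollectI exI[of _ "\<lambda>\<alpha>. a * c \<alpha>"]) simp
qed

text \<open>Here \<open>N\<close> is meant to be the maximum of \<open>\<bar>s\<bar> exp (- k Q)\<close> on \<open>K\<close>, attained at \<open>p\<close>. On the ball of radius
  \<open>d / k\<close> around \<open>p\<close> the bound near \<open>K\<close> only loses the constant factor \<open>exp (A d)\<close>, so by the Schwarz lemma
  \<open>s\<close> keeps at least half of its modulus on a smaller ball whose radius is still proportional to \<open>1 / k\<close>.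
  That ball carries a mass proportional to \<open>k ^ (- n)\<close>.\<close>

lemma L2_norm_lower_bound:
  fixes K :: "(complex ^ 'n) set"
  assumes s: "s \<in> polynomials_upto k" and k: "1 \<le> k" and N: "0 < N"
    and p: "p \<in> K" "cmod (s p) = N * exp (real k * Q p)"
    and nb: "near_bound K Q k (\<lambda>z. inverse (of_real N) * s z) (A * (d / k)) (d / k)"
    and A: "0 \<le> A" and d: "0 < d" "d \<le> \<rho>" and t: "1 \<le> t"
    and thick: "thick K \<mu> Q t \<rho> p" and \<mu>: "sets \<mu> = sets borel"
    and \<theta>_def: "\<theta> = exp (- A * d) / 6"
  shows "ennreal (N\<^sup>2 * (exp (- 2 * t * d) / 4) * ((\<theta> * d / k) ^ CARD('n) / t)) \<le> L2_norm_sq K \<mu> Q k s"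
proof -
  define R where "R = d / real k"
  have R0: "0 < R" using d k by (simp add: R_def)
  have "exp (- A * d) \<le> 1" using A d by simp
  then have \<theta>: "0 < \<theta>" "\<theta> < 1" unfolding \<theta>_def using exp_gt_zero[of "- A * d"] by linarith+
  have kR: "real k * R = d" using k by (simp add: R_def)
  have Rd: "R \<le> d" using k d divide_left_mono[of 1 "real k" d] by (simp add: R_def)
  have "\<theta> * R < 1 * R" using \<theta> R0 by (intro mult_strict_right_mono)
  moreover have "0 < \<theta> * R" using \<theta> R0 by simp
  ultimately have \<theta>R: "0 < \<theta> * R" "\<theta> * R < R" "\<theta> * R \<le> \<rho>" using Rd d by linarith+
  define B where "B = N * exp (real k * Q p) * exp (A * d)"
  have B: "cmod (s z) \<le> B" if "dist z p \<le> R" for z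
  proof -
    have "cmod (inverse (of_real N) * s z) \<le> exp (real k * (Q p + A * R))"
      using near_boundD[OF nb p(1)] that by (simp add: R_def)
    also have "real k * (Q p + A * R) = real k * Q p + A * d"
      by (simp add: algebra_simps flip: kR)
    also have "cmod (inverse (of_real N) * s z) = cmod (s z) / N"
      using N by (simp add: norm_mult norm_inverse divide_inverse mult.commute)
    finally show ?thesis
      using N by (simp add: B_def exp_add pos_divide_le_eq mult_ac)
  qed
  \<comment> \<open>The value of \<open>\<theta>\<close> makes the variation of \<open>s\<close> at most half of \<open>\<bar>s p\<bar>\<close>.\<close>
  have lower: "N * exp (real k * Q p) / 2 \<le> cmod (s z)" if z: "dist z p \<le> \<theta> * R" for z
  proof -
    have "cmod (s z - s p) \<le> 3 * B * dist z p / R"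
      using z \<theta>R N by (intro polynomials_upto_lipschitz[OF s _ B]) (auto simp: B_def)
    also have "\<dots> \<le> 3 * B * (\<theta> * R) / R"
      using z R0 N by (intro divide_right_mono mult_left_mono) (auto simp: B_def)
    also have "\<dots> = N * exp (real k * Q p) * (exp (A * d) * exp (- A * d)) / 2"
      using R0 by (simp add: B_def \<theta>_def)
    also have "\<dots> = N * exp (real k * Q p) / 2" by (simp flip: exp_add)
    finally show ?thesis
      using norm_triangle_sub[of "s p" "s z"] p(2) by (simp add: norm_minus_commute)
  qed
  obtain S where S: "S \<in> sets borel" "S \<subseteq> K \<inter> cball p (\<theta> * R)"
      "\<And>q. q \<in> S \<Longrightarrow> \<bar>Q q - Q p\<bar> \<le> t * (\<theta> * R)"
      "ennreal ((\<theta> * R) ^ CARD('n) / t) \<le> emeasure \<mu> S"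
    using thick \<theta>R unfolding thick_def by meson
  define c where "c = N\<^sup>2 * (exp (- 2 * t * d) / 4)"
  have c0: "0 \<le> c" by (simp add: c_def)
  have pointwise: "c \<le> (cmod (s q))\<^sup>2 * exp (- 2 * real k * Q q)" if q: "q \<in> S" for q
  proof -
    have "(N * exp (real k * Q p) / 2)\<^sup>2 \<le> (cmod (s q))\<^sup>2"
      using S(2) q N by (intro power_mono lower) (auto simp: dist_commute)
    then have 1: "N\<^sup>2 * exp (2 * real k * Q p) / 4 \<le> (cmod (s q))\<^sup>2"
      by (simp add: power_mult_distrib power_divide mult.assoc flip: exp_double)
    have "t * (\<theta> * R) \<le> t * R" using t \<theta>R(2) by (intro mult_left_mono) linarith+
    then have "Q q - Q p \<le> t * R" using S(3)[OF q] by linarith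
    then have "2 * real k * (Q q - Q p) \<le> 2 * real k * (t * R)" by (rule mult_left_mono) simp
    also have "\<dots> = 2 * t * d" by (simp flip: kR)
    finally have "exp (- 2 * t * d) \<le> exp (2 * real k * Q p - 2 * real k * Q q)"
      by (simp add: right_diff_distrib)
    then have "c \<le> N\<^sup>2 * exp (2 * real k * Q p - 2 * real k * Q q) / 4"
      unfolding c_def using mult_left_mono[of _ _ "N\<^sup>2 / 4"] by simp
    also have "\<dots> = N\<^sup>2 * exp (2 * real k * Q p) / 4 * exp (- 2 * real k * Q q)"
      by (simp add: exp_diff exp_minus field_simps)
    also have "\<dots> \<le> (cmod (s q))\<^sup>2 * exp (- 2 * real k * Q q)"
      using 1 by (intro mult_right_mono) auto
    finally show ?thesis .
  qed
  have "ennreal (c * ((\<theta> * R) ^ CARD('n) / t)) = ennreal c * ennreal ((\<theta> * R) ^ CARD('n) / t)"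
    using c0 by (rule ennreal_mult')
  also have "\<dots> \<le> ennreal c * emeasure \<mu> S" by (intro mult_left_mono S) auto
  also have "\<dots> = (\<integral>\<^sup>+x. ennreal c * indicator S x \<partial>\<mu>)"
    using S(1) \<mu> by (simp add: nn_integral_cmult_indicator)
  also have "\<dots> \<le> L2_norm_sq K \<mu> Q k s"
    unfolding L2_norm_sq_def
  proof (rule nn_integral_mono)
    fix x
    show "ennreal c * indicator S x
        \<le> ennreal ((cmod (s x))\<^sup>2 * exp (- 2 * real k * Q x)) * indicator K x"
      using S(2) pointwise[of x] by (cases "x \<in> S") (auto intro!: ennreal_leI)
  qed
  finally show ?thesis by (simp add: c_def R_def)
qed

lemma L2_norm_sq_restrict: "L2_norm_sq K \<mu> Q k (restrict s K) = L2_norm_sq K \<mu> Q k s"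
  unfolding L2_norm_sq_def by (intro nn_integral_cong) (simp add: indicator_def)

lemma ennreal_quotient_le:
  assumes "0 < b" "ennreal b \<le> L" "0 \<le> a" "x \<le> ennreal a"
  shows "x / L \<le> ennreal (a / b)"
proof (cases L)
  case (real l)
  then have l: "b \<le> l" using assms by simp
  have "x / L \<le> ennreal a / ennreal l" unfolding real(2) by (rule divide_right_mono_ennreal[OF assms(4)])
  also have "\<dots> = ennreal (a / l)" using assms l by (intro divide_ennreal) auto
  also have "\<dots> \<le> ennreal (a / b)" using assms l by (intro ennreal_leI divide_left_mono) auto
  finally show ?thesis .
qed (simp add: divide_ennreal_def)

theorem theorem1p5:
  fixes K :: "(complex ^ 'n) set"
    and \<omega> :: "complex ^ 'n \<Rightarrow> ('n \<Rightarrow> complex ^ 'n) \<Rightarrow> real"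
    and \<mu> :: "(complex ^ 'n) measure"
    and Q :: "complex ^ 'n \<Rightarrow> real"
    and \<delta> :: real
  assumes "compact K"
    and "maximally_totally_real 5 K"
    and "smooth_volume_form 5 K \<omega>"
    and "is_form_measure 5 K \<omega> \<mu>"
    and "\<delta> > 0"
    and "C1_Hoelder_on TYPE('n) 5 \<delta> K Q"
  shows "\<exists>C>0. \<forall>k\<ge>1. (SUP x\<in>K. bergman K \<mu> Q k x) \<le> ennreal (C * real k ^ CARD('n))"
proof -
  define \<delta>' where "\<delta>' = min \<delta> 1"
  have \<delta>': "0 < \<delta>'" "\<delta>' \<le> \<delta>" "\<delta>' \<le> 1" using assms(5) by (auto simp: \<delta>'_def)
  obtain t where t: "1 \<le> t"
    and geo: "\<And>p. p \<in> K \<Longrightarrow> osculated K Q \<delta>' t (1 / t) p \<and> thick K \<mu> Q t (1 / t) p"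
  proof (rule compact_uniform_constant[OF assms(1)])
    fix p assume "p \<in> K"
    then show "\<exists>N t. open N \<and> p \<in> N \<and> 1 \<le> t \<and>
        (\<forall>q\<in>K \<inter> N. osculated K Q \<delta>' t (1 / t) q \<and> thick K \<mu> Q t (1 / t) q)"
      by (rule local_geometry[OF assms(1-4,6) \<delta>'])
  next
    fix a b q
    assume "1 \<le> a" "a \<le> b" and 1: "osculated K Q \<delta>' a (1 / a) q \<and> thick K \<mu> Q a (1 / a) q"
    moreover from this have "1 / b \<le> 1 / a" by (intro divide_left_mono) auto
    ultimately show "osculated K Q \<delta>' b (1 / b) q \<and> thick K \<mu> Q b (1 / b) q"
      using osculated_mono thick_mono[of K \<mu> Q a] by (metis less_le_trans zero_less_one)
  qed blast
  have contQ: "continuous_on K Q"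
    using assms(2,6) unfolding maximally_totally_real_def by (blast intro: continuous_on_C1_Hoelder)
  have "bounded (Q ` K)"
    using assms(1) contQ by (intro compact_imp_bounded compact_continuous_image)
  then obtain M where "\<And>p. p \<in> K \<Longrightarrow> \<bar>Q p\<bar> \<le> M" by (auto simp: bounded_iff)
  then have M: "\<And>p. p \<in> K \<Longrightarrow> - M \<le> Q p" by (meson abs_le_D2 minus_le_iff)
  obtain A d0 where A: "0 \<le> A" and d0: "0 < d0" "d0 \<le> 1"
    and nb: "\<And>k s d. 1 \<le> k \<Longrightarrow> s \<in> polynomials_upto k \<Longrightarrow>
        (\<And>p. p \<in> K \<Longrightarrow> cmod (s p) \<le> exp (real k * Q p)) \<Longrightarrow> 0 < d \<Longrightarrow> d \<le> d0 \<Longrightarrow>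
        near_bound K Q k s (A * d) d"
    using near_bound_uniform[of K Q \<delta>' t "1 / t" M] geo \<delta>' t compact_imp_bounded[OF assms(1)] M
    by auto
  define d where "d = min d0 (1 / t)"
  have d: "0 < d" "d \<le> d0" "d \<le> 1 / t" using d0 t by (auto simp: d_def)
  define \<theta> where "\<theta> = exp (- A * d) / 6"
  define c where "c = (exp (- 2 * t * d) / 4) * ((\<theta> * d) ^ CARD('n) / t)"
  have c: "0 < c" using d t by (simp add: c_def \<theta>_def)
  have \<mu>: "sets \<mu> = sets borel" using assms(4) by (simp add: is_form_measure_def)
  have "bergman K \<mu> Q k x \<le> ennreal (1 / c * real k ^ CARD('n))" if k: "1 \<le> k" and x: "x \<in> K" for k x
    unfolding bergman_def
  proof (rule SUP_least)
    fix f assume f: "f \<in> polys_on K k - {\<lambda>z\<in>K. 0}"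
    then obtain s where s: "s \<in> polynomials_upto k" and fs: "f = restrict s K"
      by (auto simp: polys_on_def)
    define u where "u z = cmod (s z) * exp (- real k * Q z)" for z
    have "continuous_on K u"
      unfolding u_def by (intro continuous_intros continuous_on_polynomials_upto[OF s] contQ)
    then obtain p where p: "p \<in> K" "\<And>z. z \<in> K \<Longrightarrow> u z \<le> u p"
      using continuous_attains_sup[OF assms(1), of u] x by blast
    define N where "N = u p"
    have N: "0 < N"
    proof (rule ccontr)
      assume "\<not> 0 < N"
      then have "u z \<le> 0" if "z \<in> K" for z using p(2)[OF that] by (simp add: N_def)
      then have "s z = 0" if "z \<in> K" for z using that by (simp add: u_def mult_le_0_iff)
      then have "f = (\<lambda>z\<in>K. 0)" unfolding fs by (auto simp: restrict_def)
      then show False using f by simp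
    qed
    have s_u: "cmod (s z) = u z * exp (real k * Q z)" for z
      by (simp add: u_def exp_minus)
    have "near_bound K Q k (\<lambda>z. inverse (of_real N) * s z) (A * (d / k)) (d / k)"
    proof (rule nb[OF k polynomials_upto_scale[OF s]])
      show "cmod (inverse (of_real N) * s z) \<le> exp (real k * Q z)" if "z \<in> K" for z
      proof -
        have "cmod (s z) \<le> N * exp (real k * Q z)"
          unfolding s_u N_def using p(2)[OF that] by (intro mult_right_mono) auto
        moreover have "cmod (inverse (of_real N) * s z) = cmod (s z) / N"
          using N by (simp add: norm_mult norm_inverse divide_inverse mult.commute)
        ultimately show ?thesis using N by (simp add: pos_divide_le_eq mult.commute)
      qed
      show "0 < d / k" "d / k \<le> d0" using d k divide_left_mono[of 1 "real k" d] by auto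
    qed
    then have "ennreal (N\<^sup>2 * (exp (- 2 * t * d) / 4) * ((\<theta> * d / k) ^ CARD('n) / t)) \<le> L2_norm_sq K \<mu> Q k s"
      using geo[OF p(1)] t d A
      by (intro L2_norm_lower_bound[OF s k N p(1) _ _ A d(1,3) t _ \<mu> \<theta>_def]) (auto simp: s_u N_def)
    also have "N\<^sup>2 * (exp (- 2 * t * d) / 4) * ((\<theta> * d / k) ^ CARD('n) / t) = N\<^sup>2 * (c / real k ^ CARD('n))"
      by (simp add: c_def power_divide mult_ac)
    finally have lower: "ennreal (N\<^sup>2 * (c / real k ^ CARD('n))) \<le> L2_norm_sq K \<mu> Q k f"
      by (simp add: fs L2_norm_sq_restrict)
    have "(cmod (f x * of_real (exp (- real k * Q x))))\<^sup>2 = (u x)\<^sup>2"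
      using x by (simp add: fs u_def norm_mult)
    also have "\<dots> \<le> N\<^sup>2"
      unfolding N_def using x by (intro power_mono p(2)) (auto simp: u_def)
    finally have "ennreal ((cmod (f x * of_real (exp (- real k * Q x))))\<^sup>2) \<le> ennreal (N\<^sup>2)"
      by (rule ennreal_leI)
    then have "ennreal ((cmod (f x * of_real (exp (- real k * Q x))))\<^sup>2) / L2_norm_sq K \<mu> Q k f
        \<le> ennreal (N\<^sup>2 / (N\<^sup>2 * (c / real k ^ CARD('n))))"
      using N c k by (intro ennreal_quotient_le[OF _ lower]) auto
    also have "N\<^sup>2 / (N\<^sup>2 * (c / real k ^ CARD('n))) = 1 / c * real k ^ CARD('n)"
      using N by simp
    finally show "ennreal ((cmod (f x * of_real (exp (- real k * Q x))))\<^sup>2) / L2_norm_sq K \<mu> Q k f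
        \<le> ennreal (1 / c * real k ^ CARD('n))" .
  qed
  then have "\<forall>k\<ge>1. (SUP x\<in>K. bergman K \<mu> Q k x) \<le> ennreal (1 / c * real k ^ CARD('n))"
    by (auto intro: SUP_least)
  then show ?thesis using c by (intro exI[of _ "1 / c"]) auto
qed

end
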